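(* Let $n,k,d,d_p$ be positive integers with $d_p\ge n$, and let $\mathbf{P}\in\mathbb{R}^{n\times d_p}$ have orthonormal rows. Let $L:\mathbb{R}^{n^k\times d}\to\mathbb{R}^{n^k\times d}$ be any order-$k$ equivariant linear layer. Then for every compact set $K\subset\mathbb{R}^{n^k\times d}$ and every $\delta>0$ there exist a type identifier dimension $d_e$, type identifiers $\mathbf{E}^\gamma\in\mathbb{R}^{d_e}$ (one per order-$k$ equivalence class $\gamma$), a hidden dimension $d_{\mathcal{T}}\ge d$, an input projection $w^{in}\in\mathbb{R}^{(d+kd_p+d_e)\times d_{\mathcal{T}}}$, and a Transformer layer $\mathcal{T}:\mathbb{R}^{n^k\times d_{\mathcal{T}}}\to\mathbb{R}^{n^k\times d_{\mathcal{T}}}$ with $\mathrm{bell}(2k)$ self-attention heads such that for all $\mathbf{X}\in K$ and all $\mathbf{i}\in[n]^k$, the first $d$ coordinates of $\mathcal{T}(\mathbf{X}^{in}w^{in})_{\mathbf{i}}$ are within distance $\delta$ of $L(\mathbf{X})_{\mathbf{i}}$.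
   Context: Equivalence classes: for $l\ge1$, $\mathbf{i}\sim\mathbf{j}$ in $[n]^l$ iff $\mathbf{i}=(\pi(j_1),\dots,\pi(j_l))$ for some $\pi\in S_n$; order-$l$ equivalence classes are the elements of $[n]^l/_\sim$ (there are $\mathrm{bell}(l)$ of them for $n\ge l$, where $\mathrm{bell}$ denotes the Bell numbers). The basis tensor of an order-$l$ class $\gamma$ is $\mathbf{B}^\gamma\in\mathbb{R}^{n^l}$ with $\mathbf{B}^\gamma_{\mathbf{i}}=1$ if $\mathbf{i}\in\gamma$, else $0$. An order-$k$ equivariant linear layer $L:\mathbb{R}^{n^k\times d}\to\mathbb{R}^{n^k\times d}$ is a map of the form $L(\mathbf{X})_{\mathbf{i}}=\sum_{\mu}\sum_{\mathbf{j}\in[n]^k}\mathbf{B}^\mu_{\mathbf{i},\mathbf{j}}\mathbf{X}_{\mathbf{j}}w_\mu+\sum_{\lambda}\mathbf{C}^\lambda_{\mathbf{i}}b_\lambda$, where $\mu$ ranges over order-$2k$ classes with basis tensors $\mathbf{B}^\mu$ (entry $\mathbf{B}^\mu_{\mathbf{i},\mathbf{j}}$ at the concatenated index $(\mathbf{i},\mathbf{j})$), $\lambda$ ranges over order-$k$ classes with basis tensors $\mathbf{C}^\lambda$, and $w_\mu\in\mathbb{R}^{d\times d}$, $b_\lambda\in\mathbb{R}^d$ are arbitrary. Augmentation: $\mathbf{X}^{in}_{\mathbf{i}}=[\mathbf{X}_{\mathbf{i}},\mathbf{P}_{i_1},\dots,\mathbf{P}_{i_k},\mathbf{E}^{\gamma}]$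 where $\gamma\ni\mathbf{i}$. A Transformer layer (without layer normalization) acting on $\mathbf{Z}\in\mathbb{R}^{N\times d_{\mathcal{T}}}$, $N=n^k$, is $\mathcal{T}(\mathbf{Z})=\mathbf{H}+\mathrm{MLP}(\mathbf{H})$ with $\mathbf{H}=\mathbf{Z}+\mathrm{MSA}(\mathbf{Z})$, where $\mathrm{MSA}(\mathbf{Z})_{\mathbf{i}}=\sum_{h=1}^H\sum_{\mathbf{j}}\boldsymbol{\alpha}^h_{\mathbf{i},\mathbf{j}}\mathbf{Z}_{\mathbf{j}}w^V_hw^O_h$, $\boldsymbol{\alpha}^h=\mathrm{softmax}\big((\mathbf{Z}w^Q_h+\mathbf{1}(b^Q_h)^\top)(\mathbf{Z}w^K_h+\mathbf{1}(b^K_h)^\top)^\top/\sqrt{d_H}\big)$ (row-wise softmax), $w^Q_h,w^K_h\in\mathbb{R}^{d_{\mathcal{T}}\times d_H}$, $w^V_h\in\mathbb{R}^{d_{\mathcal{T}}\times d_v}$, $w^O_h\in\mathbb{R}^{d_v\times d_{\mathcal{T}}}$, and $\mathrm{MLP}$ is a tokenwise (same for every row) feedforward network of arbitrary width with a fixed continuous non-polynomial activation. *)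

theory Defs
  imports "HOL-Analysis.Analysis" "HOL-Combinatorics.Permutations" "HOL-Combinatorics.Stirling"
          "HOL-Computational_Algebra.Polynomial"
begin

definition bell :: "nat \<Rightarrow> nat" where
  "bell l = (\<Sum>j\<le>l. Stirling l j)"

definition idx :: "nat \<Rightarrow> nat \<Rightarrow> nat list set" where
  "idx n l = {xs. length xs = l \<and> set xs \<subseteq> {..<n}}"

definition sim_rel :: "nat \<Rightarrow> nat \<Rightarrow> (nat list \<times> nat list) set" where
  "sim_rel n l = {(i, j). i \<in> idx n l \<and> j \<in> idx n l \<and>
                    (\<exists>\<pi>. \<pi> permutes {..<n} \<and> i = map \<pi> j)}"

definition eq_classes :: "nat \<Rightarrow> nat \<Rightarrow> nat list set set" where
  "eq_classes n l = idx n l // sim_rel n l"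

definition class_of :: "nat \<Rightarrow> nat \<Rightarrow> nat list \<Rightarrow> nat list set" where
  "class_of n l i = sim_rel n l `` {i}"

definition basis_tensor :: "nat list set \<Rightarrow> nat list \<Rightarrow> real" where
  "basis_tensor \<gamma> i = (if i \<in> \<gamma> then 1 else 0)"

(* Tensors X in R^{n^k x d} are functions  nat list => nat => real  (multi-index, feature);
   matrices are functions  nat => nat => real  (row, column); vectors  nat => real. *)

definition equiv_layer ::
  "nat \<Rightarrow> nat \<Rightarrow> nat \<Rightarrow> (nat list set \<Rightarrow> nat \<Rightarrow> nat \<Rightarrow> real) \<Rightarrow> (nat list set \<Rightarrow> nat \<Rightarrow> real)
   \<Rightarrow> (nat list \<Rightarrow> nat \<Rightarrow> real) \<Rightarrow> nat list \<Rightarrow> nat \<Rightarrow> real" where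
  "equiv_layer n k d w b X i c =
     (\<Sum>\<mu>\<in>eq_classes n (2*k). \<Sum>j\<in>idx n k.
         basis_tensor \<mu> (i @ j) * (\<Sum>a<d. X j a * w \<mu> a c))
   + (\<Sum>\<nu>\<in>eq_classes n k. basis_tensor \<nu> i * b \<nu> c)"

(* augmented input X^in_i = [X_i, P_{i_1}, ..., P_{i_k}, E^gamma], of length d + k*dp + de *)
definition augment ::
  "nat \<Rightarrow> nat \<Rightarrow> nat \<Rightarrow> nat \<Rightarrow> (nat \<Rightarrow> nat \<Rightarrow> real) \<Rightarrow> (nat list set \<Rightarrow> nat \<Rightarrow> real)
   \<Rightarrow> (nat list \<Rightarrow> nat \<Rightarrow> real) \<Rightarrow> nat list \<Rightarrow> nat \<Rightarrow> real" where
  "augment n k d dp P E X i c =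
     (if c < d then X i c
      else if c < d + k * dp then P (i ! ((c - d) div dp)) ((c - d) mod dp)
      else E (class_of n k i) (c - d - k * dp))"

definition tok_matmul :: "nat \<Rightarrow> ('i \<Rightarrow> nat \<Rightarrow> real) \<Rightarrow> (nat \<Rightarrow> nat \<Rightarrow> real) \<Rightarrow> 'i \<Rightarrow> nat \<Rightarrow> real" where
  "tok_matmul m X w i c = (\<Sum>a<m. X i a * w a c)"

definition msa ::
  "nat list set \<Rightarrow> nat \<Rightarrow> nat \<Rightarrow> nat \<Rightarrow> nat
   \<Rightarrow> (nat \<Rightarrow> nat \<Rightarrow> nat \<Rightarrow> real) \<Rightarrow> (nat \<Rightarrow> nat \<Rightarrow> real)
   \<Rightarrow> (nat \<Rightarrow> nat \<Rightarrow> nat \<Rightarrow> real) \<Rightarrow> (nat \<Rightarrow> nat \<Rightarrow> real)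
   \<Rightarrow> (nat \<Rightarrow> nat \<Rightarrow> nat \<Rightarrow> real) \<Rightarrow> (nat \<Rightarrow> nat \<Rightarrow> nat \<Rightarrow> real)
   \<Rightarrow> (nat list \<Rightarrow> nat \<Rightarrow> real) \<Rightarrow> nat list \<Rightarrow> nat \<Rightarrow> real" where
  "msa N dT H dH dv wQ bQ wK bK wV wO Z i c =
     (let score = (\<lambda>h i j. (\<Sum>e<dH. (tok_matmul dT Z (wQ h) i e + bQ h e)
                                  * (tok_matmul dT Z (wK h) j e + bK h e)) / sqrt (real dH));
          alpha = (\<lambda>h i j. exp (score h i j) / (\<Sum>j'\<in>N. exp (score h i j')))
      in (\<Sum>h<H. \<Sum>j\<in>N. alpha h i j *
             (\<Sum>v<dv. tok_matmul dT Z (wV h) j v * wO h v c)))"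

definition mlp ::
  "(real \<Rightarrow> real) \<Rightarrow> nat \<Rightarrow> nat \<Rightarrow> (nat \<Rightarrow> nat \<Rightarrow> real) \<Rightarrow> (nat \<Rightarrow> real)
   \<Rightarrow> (nat \<Rightarrow> nat \<Rightarrow> real) \<Rightarrow> (nat \<Rightarrow> real) \<Rightarrow> (nat \<Rightarrow> real) \<Rightarrow> nat \<Rightarrow> real" where
  "mlp \<sigma> dT m W1 b1 W2 b2 x c =
     (\<Sum>r<m. \<sigma> ((\<Sum>a<dT. x a * W1 a r) + b1 r) * W2 r c) + b2 c"

(* Transformer layer without layer normalization: T(Z) = Hm + MLP(Hm), Hm = Z + MSA(Z) *)
definition transformer_layer ::
  "nat list set \<Rightarrow> nat \<Rightarrow> nat \<Rightarrow> nat \<Rightarrow> nat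
   \<Rightarrow> (nat \<Rightarrow> nat \<Rightarrow> nat \<Rightarrow> real) \<Rightarrow> (nat \<Rightarrow> nat \<Rightarrow> real)
   \<Rightarrow> (nat \<Rightarrow> nat \<Rightarrow> nat \<Rightarrow> real) \<Rightarrow> (nat \<Rightarrow> nat \<Rightarrow> real)
   \<Rightarrow> (nat \<Rightarrow> nat \<Rightarrow> nat \<Rightarrow> real) \<Rightarrow> (nat \<Rightarrow> nat \<Rightarrow> nat \<Rightarrow> real)
   \<Rightarrow> (real \<Rightarrow> real) \<Rightarrow> nat \<Rightarrow> (nat \<Rightarrow> nat \<Rightarrow> real) \<Rightarrow> (nat \<Rightarrow> real)
   \<Rightarrow> (nat \<Rightarrow> nat \<Rightarrow> real) \<Rightarrow> (nat \<Rightarrow> real)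
   \<Rightarrow> (nat list \<Rightarrow> nat \<Rightarrow> real) \<Rightarrow> nat list \<Rightarrow> nat \<Rightarrow> real" where
  "transformer_layer N dT H dH dv wQ bQ wK bK wV wO \<sigma> m W1 b1 W2 b2 Z i c =
     (let Hm = (\<lambda>i c. Z i c + msa N dT H dH dv wQ bQ wK bK wV wO Z i c)
      in Hm i c + mlp \<sigma> dT m W1 b1 W2 b2 (Hm i) c)"

end

theory Submission
  imports Defs
begin

text \<open>
  One attention head is spent on each order-\<open>2k\<close> class \<open>\<mu>\<close>. Since the rows of \<open>P\<close> are orthonormal, a bilinear
  score can read off all equalities between entries of \<open>i\<close> and \<open>j\<close>, and together with the type identifier
  of \<open>j\<close> it is maximal exactly at those \<open>j\<close> with \<open>(i, j) \<in> \<mu>\<close>, provided that \<open>i\<close> has the type required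
  by \<open>\<mu>\<close>. At a low temperature the softmax is then almost uniform on these \<open>j\<close>, whose number depends only on
  \<open>\<mu>\<close>, so that rescaling gives the sum over \<open>j\<close> in the linear layer. For \<open>i\<close> of any other type the head
  outputs something bounded but meaningless. The feedforward network removes it by multiplying with the
  0/1-valued type identifier of \<open>i\<close>, and such products reduce to approximating \<open>x\<^sup>2\<close> by combinations of
  \<open>\<sigma> (a x + b)\<close>. For this it is enough that \<open>\<sigma>\<close> is continuous and not affine.
\<close>

section \<open>Approximation of the square by ridge combinations\<close>

text \<open>The softmax weights of a row sum to 1: a score can redirect a head but not switch it
  off, which is why rows of the wrong type are dealt with only after attention. They stay harmless
  because a head output is an average of bounded values, with a bound independent of the scores, so
  the network has to be accurate only on a fixed bounded range. The gating factor is exact: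
  attention writes to coordinates that are empty beforehand and leaves the type identifier as it
  was, so the factor is 0 or 1 without error. The prescribed \<open>bell (2*k)\<close> may exceed
  the number of order-2k classes, since patterns with more than \<open>n\<close> values do not
  occur; surplus heads write to blocks that the network ignores. The bias of the linear layer needs
  no attention: the one-hot type identifier lets the input projection place it in the output
  coordinates from the start.\<close>

definition approximable :: "(real \<Rightarrow> real) \<Rightarrow> (real \<Rightarrow> real) \<Rightarrow> bool" where
  "approximable \<sigma> g \<longleftrightarrow> (\<forall>R \<epsilon>. 0 < \<epsilon> \<longrightarrow>
     (\<exists>(Q::nat) u a b. \<forall>x. \<bar>x\<bar> \<le> R \<longrightarrow> \<bar>(\<Sum>q<Q. u q * \<sigma> (a q * x + b q)) - g x\<bar> < \<epsilon>))"

lemma approximableE: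
  assumes "approximable \<sigma> g" "0 < \<epsilon>"
  obtains Q :: nat and u a b where
    "\<And>x. \<bar>x\<bar> \<le> R \<Longrightarrow> \<bar>(\<Sum>q<Q. u q * \<sigma> (a q * x + b q)) - g x\<bar> < \<epsilon>"
  using assms unfolding approximable_def by metis

lemma approximable_self: "approximable \<sigma> \<sigma>"
  unfolding approximable_def
proof (intro allI impI)
  fix R \<epsilon> :: real assume "0 < \<epsilon>"
  then show "\<exists>(Q::nat) u a b. \<forall>x. \<bar>x\<bar> \<le> R \<longrightarrow> \<bar>(\<Sum>q<Q. u q * \<sigma> (a q * x + b q)) - \<sigma> x\<bar> < \<epsilon>"
    by (intro exI[of _ "1::nat"] exI[of _ "\<lambda>_. 1::real"] exI[of _ "\<lambda>_. 0::real"]) simp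
qed

lemma approximable_affine:
  assumes "approximable \<sigma> g"
  shows "approximable \<sigma> (\<lambda>x. g (\<alpha> * x + \<beta>))"
  unfolding approximable_def
proof (intro allI impI)
  fix R \<epsilon> :: real assume "0 < \<epsilon>"
  obtain Q u a b where *: "\<And>x. \<bar>x\<bar> \<le> \<bar>\<alpha>\<bar> * R + \<bar>\<beta>\<bar> \<Longrightarrow>
      \<bar>(\<Sum>q<(Q::nat). u q * \<sigma> (a q * x + b q)) - g x\<bar> < \<epsilon>"
    using approximableE[OF assms \<open>0 < \<epsilon>\<close>] by metis
  show "\<exists>(Q::nat) u a b. \<forall>x. \<bar>x\<bar> \<le> R \<longrightarrow>
      \<bar>(\<Sum>q<Q. u q * \<sigma> (a q * x + b q)) - g (\<alpha> * x + \<beta>)\<bar> < \<epsilon>"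
  proof (intro exI allI impI)
    fix x :: real assume "\<bar>x\<bar> \<le> R"
    then have "\<bar>\<alpha> * x + \<beta>\<bar> \<le> \<bar>\<alpha>\<bar> * R + \<bar>\<beta>\<bar>"
      by (intro order_trans[OF abs_triangle_ineq]) (simp add: abs_mult mult_left_mono)
    from *[OF this]
    show "\<bar>(\<Sum>q<Q. u q * \<sigma> (a q * \<alpha> * x + (a q * \<beta> + b q))) - g (\<alpha> * x + \<beta>)\<bar> < \<epsilon>"
      by (simp add: algebra_simps)
  qed
qed

lemma approximable_scale:
  assumes "approximable \<sigma> g"
  shows "approximable \<sigma> (\<lambda>x. s * g x)"
  unfolding approximable_def
proof (intro allI impI)
  fix R \<epsilon> :: real assume "0 < \<epsilon>"
  then have "0 < \<epsilon> / (\<bar>s\<bar> + 1)" by simp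
  then obtain Q u a b where *: "\<And>x. \<bar>x\<bar> \<le> R \<Longrightarrow>
      \<bar>(\<Sum>q<(Q::nat). u q * \<sigma> (a q * x + b q)) - g x\<bar> < \<epsilon> / (\<bar>s\<bar> + 1)"
    using approximableE[OF assms] by metis
  show "\<exists>(Q::nat) u a b. \<forall>x. \<bar>x\<bar> \<le> R \<longrightarrow>
      \<bar>(\<Sum>q<Q. u q * \<sigma> (a q * x + b q)) - s * g x\<bar> < \<epsilon>"
  proof (intro exI allI impI)
    fix x :: real assume "\<bar>x\<bar> \<le> R"
    let ?D = "(\<Sum>q<Q. u q * \<sigma> (a q * x + b q)) - g x"
    have D: "\<bar>?D\<bar> < \<epsilon> / (\<bar>s\<bar> + 1)" using *[OF \<open>\<bar>x\<bar> \<le> R\<close>] .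
    have "\<bar>s * ?D\<bar> \<le> (\<bar>s\<bar> + 1) * \<bar>?D\<bar>"
      unfolding abs_mult by (rule mult_right_mono) auto
    also have "\<dots> < \<epsilon>"
      using D by (simp add: field_simps pos_less_divide_eq add_pos_nonneg)
    finally show "\<bar>(\<Sum>q<Q. s * u q * \<sigma> (a q * x + b q)) - s * g x\<bar> < \<epsilon>"
      by (simp add: right_diff_distrib sum_distrib_left mult.assoc)
  qed
qed

lemma sum_lessThan_append:
  fixes f g :: "nat \<Rightarrow> real"
  shows "(\<Sum>q<m + m'. if q < m then f q else g (q - m)) = (\<Sum>q<m. f q) + (\<Sum>q<m'. g q)"
  by (induction m') auto

lemma approximable_add:
  assumes "approximable \<sigma> g" "approximable \<sigma> g'"
  shows "approximable \<sigma> (\<lambda>x. g x + g' x)"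
  unfolding approximable_def
proof (intro allI impI)
  fix R \<epsilon> :: real assume "0 < \<epsilon>"
  then have "0 < \<epsilon> / 2" by simp
  obtain Q u a b where 1: "\<And>x. \<bar>x\<bar> \<le> R \<Longrightarrow>
      \<bar>(\<Sum>q<(Q::nat). u q * \<sigma> (a q * x + b q)) - g x\<bar> < \<epsilon> / 2"
    using approximableE[OF assms(1) \<open>0 < \<epsilon> / 2\<close>] by metis
  obtain Q' u' a' b' where 2: "\<And>x. \<bar>x\<bar> \<le> R \<Longrightarrow>
      \<bar>(\<Sum>q<(Q'::nat). u' q * \<sigma> (a' q * x + b' q)) - g' x\<bar> < \<epsilon> / 2"
    using approximableE[OF assms(2) \<open>0 < \<epsilon> / 2\<close>] by metis
  define app :: "(nat \<Rightarrow> real) \<Rightarrow> (nat \<Rightarrow> real) \<Rightarrow> nat \<Rightarrow> real"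
    where "app f f' q = (if q < Q then f q else f' (q - Q))" for f f' q
  show "\<exists>(Q::nat) u a b. \<forall>x. \<bar>x\<bar> \<le> R \<longrightarrow>
      \<bar>(\<Sum>q<Q. u q * \<sigma> (a q * x + b q)) - (g x + g' x)\<bar> < \<epsilon>"
  proof (intro exI allI impI)
    fix x :: real assume "\<bar>x\<bar> \<le> R"
    have "(\<Sum>q<Q + Q'. app u u' q * \<sigma> (app a a' q * x + app b b' q)) =
        (\<Sum>q<Q + Q'. if q < Q then u q * \<sigma> (a q * x + b q)
           else u' (q - Q) * \<sigma> (a' (q - Q) * x + b' (q - Q)))"
      by (intro sum.cong) (auto simp: app_def)
    then show "\<bar>(\<Sum>q<Q + Q'. app u u' q * \<sigma> (app a a' q * x + app b b' q)) - (g x + g' x)\<bar> < \<epsilon>"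
      using 1[OF \<open>\<bar>x\<bar> \<le> R\<close>] 2[OF \<open>\<bar>x\<bar> \<le> R\<close>]
        sum_lessThan_append[of Q "\<lambda>q. u q * \<sigma> (a q * x + b q)" "\<lambda>q. u' q * \<sigma> (a' q * x + b' q)" Q']
      by linarith
  qed
qed

lemma approximable_sum:
  assumes "\<And>q. q < (m::nat) \<Longrightarrow> approximable \<sigma> (g q)" "0 < m"
  shows "approximable \<sigma> (\<lambda>x. \<Sum>q<m. g q x)"
  using assms
proof (induction m)
  case (Suc m)
  then show ?case by (cases "m = 0") (auto intro!: approximable_add)
qed simp

text \<open>Allows the later arguments to exhibit a nearby approximable function, which may vary
  with \<open>R\<close> and \<open>\<epsilon>\<close>, instead of explicit coefficients.\<close>

lemma approximable_limit:
  assumes "\<And>R \<epsilon>. 0 < \<epsilon> \<Longrightarrow> \<exists>g'. approximable \<sigma> g' \<and> (\<forall>x. \<bar>x\<bar> \<le> R \<longrightarrow> \<bar>g' x - g x\<bar> < \<epsilon>)"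
  shows "approximable \<sigma> g"
  unfolding approximable_def
proof (intro allI impI)
  fix R \<epsilon> :: real assume "0 < \<epsilon>"
  then have "0 < \<epsilon> / 2" by simp
  then obtain g' where g': "approximable \<sigma> g'" "\<And>x. \<bar>x\<bar> \<le> R \<Longrightarrow> \<bar>g' x - g x\<bar> < \<epsilon> / 2"
    using assms by metis
  obtain Q u a b where *: "\<And>x. \<bar>x\<bar> \<le> R \<Longrightarrow>
      \<bar>(\<Sum>q<(Q::nat). u q * \<sigma> (a q * x + b q)) - g' x\<bar> < \<epsilon> / 2"
    using approximableE[OF g'(1) \<open>0 < \<epsilon> / 2\<close>] by metis
  show "\<exists>(Q::nat) u a b. \<forall>x. \<bar>x\<bar> \<le> R \<longrightarrow> \<bar>(\<Sum>q<Q. u q * \<sigma> (a q * x + b q)) - g x\<bar> < \<epsilon>"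
  proof (intro exI allI impI)
    fix x :: real assume "\<bar>x\<bar> \<le> R"
    from *[OF this] g'(2)[OF this] show "\<bar>(\<Sum>q<Q. u q * \<sigma> (a q * x + b q)) - g x\<bar> < \<epsilon>"
      by linarith
  qed
qed

text \<open>The increment telescopes over a fine partition; the mean value theorem turns it into a
  Riemann sum of translates of the derivative.\<close>

lemma approximable_increment:
  fixes g G :: "real \<Rightarrow> real"
  assumes g: "approximable \<sigma> g" "continuous_on UNIV g"
    and G: "\<And>x. (G has_real_derivative g x) (at x)" and "0 < \<eta>"
  shows "approximable \<sigma> (\<lambda>x. G (x + \<eta>) - G x)"
proof (rule approximable_limit)
  fix R \<epsilon> :: real assume "0 < \<epsilon>"
  have "uniformly_continuous_on {-R..R + \<eta>} g"
    by (intro compact_uniformly_continuous continuous_on_subset[OF g(2)]) auto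
  moreover have "0 < \<epsilon> / (2 * \<eta>)" using \<open>0 < \<epsilon>\<close> \<open>0 < \<eta>\<close> by simp
  ultimately obtain \<rho> where "0 < \<rho>" and \<rho>:
    "\<And>x y. x \<in> {-R..R + \<eta>} \<Longrightarrow> y \<in> {-R..R + \<eta>} \<Longrightarrow> \<bar>y - x\<bar> < \<rho> \<Longrightarrow> \<bar>g y - g x\<bar> < \<epsilon> / (2 * \<eta>)"
    unfolding uniformly_continuous_on_def dist_real_def by metis
  obtain N :: nat where N: "\<eta> / \<rho> < N" using reals_Archimedean2 by blast
  have "0 < N" using N \<open>0 < \<eta>\<close> \<open>0 < \<rho>\<close> by (cases N) (auto simp: field_simps)
  define s where "s = \<eta> / N"
  have s: "0 < s" "s < \<rho>" "N * s = \<eta>"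
    using N \<open>0 < N\<close> \<open>0 < \<eta>\<close> \<open>0 < \<rho>\<close> by (auto simp: s_def field_simps)
  show "\<exists>g'. approximable \<sigma> g' \<and> (\<forall>x. \<bar>x\<bar> \<le> R \<longrightarrow> \<bar>g' x - (G (x + \<eta>) - G x)\<bar> < \<epsilon>)"
  proof (intro exI conjI allI impI)
    have "approximable \<sigma> (\<lambda>x. g (1 * x + q * s))" for q :: nat
      by (rule approximable_affine[OF g(1)])
    then show "approximable \<sigma> (\<lambda>x. \<Sum>q<N. s * g (x + real q * s))"
      by (intro approximable_sum approximable_scale) (auto simp: \<open>0 < N\<close>)
    fix x :: real assume x: "\<bar>x\<bar> \<le> R"
    have step: "\<bar>s * g (x + q * s) - (G (x + Suc q * s) - G (x + q * s))\<bar> \<le> s * (\<epsilon> / (2 * \<eta>))"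
      if "q < N" for q :: nat
    proof -
      have "x + q * s < x + Suc q * s" using s by (simp add: algebra_simps)
      then obtain \<xi> where \<xi>: "x + q * s < \<xi>" "\<xi> < x + Suc q * s"
        "G (x + Suc q * s) - G (x + q * s) = (x + Suc q * s - (x + q * s)) * g \<xi>"
        using MVT2[of "x + q * s" "x + Suc q * s" G g] G by blast
      have "real (Suc q) * s \<le> N * s" using that s by (intro mult_right_mono) auto
      moreover have "0 \<le> real q * s" using s by simp
      moreover have "real (Suc q) * s = q * s + s" by (simp add: algebra_simps)
      ultimately have "-R \<le> x + q * s" "x + q * s \<le> R + \<eta>" "-R \<le> \<xi>" "\<xi> \<le> R + \<eta>" "\<bar>x + q * s - \<xi>\<bar> < \<rho>"
        using \<xi>(1,2) x s by linarith+
      then have "\<bar>g (x + q * s) - g \<xi>\<bar> < \<epsilon> / (2 * \<eta>)" by (intro \<rho>) auto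
      then have "s * \<bar>g (x + q * s) - g \<xi>\<bar> \<le> s * (\<epsilon> / (2 * \<eta>))"
        using s by (intro mult_left_mono) auto
      moreover have "s * g (x + q * s) - (G (x + Suc q * s) - G (x + q * s)) = s * (g (x + q * s) - g \<xi>)"
        unfolding \<xi>(3) by (simp add: algebra_simps)
      ultimately show ?thesis using s by (simp add: abs_mult)
    qed
    have "G (x + \<eta>) - G x = (\<Sum>q<N. G (x + Suc q * s) - G (x + q * s))"
      using sum_lessThan_telescope[of "\<lambda>q. G (x + real q * s)" N] s by simp
    then have "\<bar>(\<Sum>q<N. s * g (x + q * s)) - (G (x + \<eta>) - G x)\<bar> =
        \<bar>\<Sum>q<N. s * g (x + q * s) - (G (x + Suc q * s) - G (x + q * s))\<bar>"
      by (simp only: sum_subtractf)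
    also have "\<dots> \<le> (\<Sum>q<N. s * (\<epsilon> / (2 * \<eta>)))"
      by (rule order_trans[OF sum_abs]) (intro sum_mono step, simp)
    also have "\<dots> = N * s * (\<epsilon> / (2 * \<eta>))" by simp
    also have "\<dots> = \<epsilon> / 2" unfolding s(3) using \<open>0 < \<eta>\<close> by simp
    also have "\<dots> < \<epsilon>" using \<open>0 < \<epsilon>\<close> by simp
    finally show "\<bar>(\<Sum>q<N. s * g (x + real q * s)) - (G (x + \<eta>) - G x)\<bar> < \<epsilon>" .
  qed
qed

section \<open>Continuous functions with vanishing second differences\<close>

lemma continuous_imp_antiderivative:
  fixes g :: "real \<Rightarrow> real"
  assumes "continuous_on UNIV g"
  obtains G where "\<And>x. (G has_real_derivative g x) (at x)"
proof -
  have "isCont g x" for x using assms by (simp add: continuous_on_eq_continuous_at)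
  then show thesis
    using that einterval_antiderivative[of "-\<infinity>" "\<infinity>" g]
    by (auto simp: has_real_derivative_iff_has_vector_derivative)
qed

text \<open>Integrating additivity over a unit interval shows that a continuous additive function is
  differentiable with constant derivative.\<close>

lemma continuous_additive_imp_linear:
  fixes g :: "real \<Rightarrow> real"
  assumes cont: "continuous_on UNIV g" and add: "\<And>x y. g (x + y) = g x + g y"
  shows "g x = g 1 * x"
proof -
  obtain G where G: "\<And>x. (G has_real_derivative g x) (at x)"
    using continuous_imp_antiderivative[OF cont] by blast
  have shift: "((\<lambda>y. G (x + y)) has_real_derivative g (x + y)) (at y)" for x y
    by (rule DERIV_cong[OF DERIV_chain2[OF G]]) (auto intro!: derivative_eq_intros)
  have gG: "g x = G (x + 1) - G x - (G 1 - G 0)" for x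
  proof -
    have "((\<lambda>y. G (x + y) - G y - y * g x) has_real_derivative 0) (at y)" for y
      by (rule DERIV_cong[OF DERIV_diff[OF DERIV_diff[OF shift G] DERIV_cmult_right[OF DERIV_ident]]])
         (simp add: add)
    then have "G (x + 1) - G 1 - 1 * g x = G (x + 0) - G 0 - 0 * g x"
      by (intro DERIV_isconst_all[of "\<lambda>y. G (x + y) - G y - y * g x"]) auto
    then show ?thesis by simp
  qed
  have "((\<lambda>x. G (x + 1) - G x - (G 1 - G 0)) has_real_derivative g (x + 1) - g x) (at x)" for x
    using shift[of 1 x] by (auto intro!: derivative_eq_intros G simp: add.commute)
  moreover have "g = (\<lambda>x. G (x + 1) - G x - (G 1 - G 0))" by (rule ext) (rule gG)
  ultimately have "(g has_real_derivative g (x + 1) - g x) (at x)" for x by metis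
  then have "(g has_real_derivative g 1) (at x)" for x using add[of x 1] by (metis add_diff_cancel_left')
  then have "((\<lambda>x. g x - g 1 * x) has_real_derivative 0) (at x)" for x
    by (auto intro!: derivative_eq_intros)
  then have "g x - g 1 * x = g 0 - g 1 * 0"
    by (intro DERIV_isconst_all) auto
  moreover have "g 0 = 0" using add[of 0 0] by simp
  ultimately show ?thesis by simp
qed

text \<open>With step \<open>(v - u) / 2\<close> the hypothesis is the midpoint equation for
  \<open>u\<close> and \<open>v\<close>. Comparing the midpoint of \<open>u, v\<close> with that of
  \<open>u + v, 0\<close> makes \<open>\<sigma>\<close> minus its value at 0 additive.\<close>

lemma zero_second_difference_imp_affine:
  fixes \<sigma> :: "real \<Rightarrow> real"
  assumes cont: "continuous_on UNIV \<sigma>"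
    and zero: "\<And>x \<eta>. 0 < \<eta> \<Longrightarrow> \<sigma> (x + 2 * \<eta>) - 2 * \<sigma> (x + \<eta>) + \<sigma> x = 0"
  shows "\<exists>a b. \<forall>x. \<sigma> x = a + b * x"
proof -
  define g where "g x = \<sigma> x - \<sigma> 0" for x
  have lt: "2 * g ((u + v) / 2) = g u + g v" if "u < v" for u v
    using zero[of "(v - u) / 2" u] that by (simp add: g_def field_simps)
  have mid: "2 * g ((u + v) / 2) = g u + g v" for u v
    using lt[of u v] lt[of v u] by (cases u v rule: linorder_cases) (auto simp: add.commute)
  have "g (u + v) = g u + g v" for u v
    using mid[of u v] mid[of "u + v" 0] by (simp add: g_def)
  moreover have "continuous_on UNIV g"
    unfolding g_def by (intro continuous_intros cont)
  ultimately have "g x = g 1 * x" for x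
    by (intro continuous_additive_imp_linear) auto
  then have "\<sigma> x = \<sigma> 0 + g 1 * x" for x
    using g_def[of x] by (metis add_diff_cancel_left' diff_add_cancel add.commute)
  then show ?thesis by blast
qed

text \<open>The symmetric second difference at \<open>z\<close> has no constant or linear term, so
  near \<open>z\<close> it is \<open>f'' z * u\<^sup>2\<close> up to a small relative error.
  Rescaling the argument stretches this neighbourhood of \<open>z\<close> over the whole range
  \<open>\<bar>x\<bar> \<le> R\<close>.\<close>

lemma approximable_square_if_C2:
  fixes f :: "real \<Rightarrow> real"
  assumes f: "approximable \<sigma> f" and f': "\<And>x. (f has_real_derivative f' x) (at x)"
    and f'': "\<And>x. (f' has_real_derivative f'' x) (at x)"
    and cont: "continuous_on UNIV f''" and nz: "f'' z \<noteq> 0"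
  shows "approximable \<sigma> (\<lambda>x. x\<^sup>2)"
proof (rule approximable_limit)
  fix R \<epsilon> :: real assume "0 < \<epsilon>"
  define C where "C = f'' z"
  define \<psi> where "\<psi> u = f (z + u) + f (z - u) - 2 * f z" for u
  \<comment> \<open>After division by \<open>\<bar>C\<bar>\<close> the error at \<open>x\<close> is
    \<open>\<epsilon> * (x\<^sup>2 / (R\<^sup>2 + 1))\<close>, which is strictly below
    \<open>\<epsilon>\<close>.\<close>
  define e where "e = \<epsilon> * \<bar>C\<bar> / (R\<^sup>2 + 1)"
  have "0 < R\<^sup>2 + 1" by (simp add: add_nonneg_pos)
  have "0 < e" using \<open>0 < \<epsilon>\<close> nz \<open>0 < R\<^sup>2 + 1\<close> by (simp add: e_def C_def)
  have "isCont f'' z" using cont by (simp add: continuous_on_eq_continuous_at)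
  then obtain \<rho> where "0 < \<rho>" and \<rho>: "\<And>x. \<bar>x - z\<bar> < \<rho> \<Longrightarrow> \<bar>f'' x - C\<bar> < e"
    using \<open>0 < e\<close> unfolding continuous_at_eps_delta dist_real_def C_def by metis
  have taylor: "\<bar>\<psi> u - C * u\<^sup>2\<bar> \<le> e * u\<^sup>2" if u: "\<bar>u\<bar> < \<rho>" for u
  proof -
    \<comment> \<open>The derivatives of \<open>\<psi>\<close> in the form of Maclaurin's theorem;
      \<open>D 0 0\<close> and \<open>D 1 0\<close> vanish, which leaves only the remainder of order
      two.\<close>
    define D where "D m = (if m = 0 then \<psi> else if m = 1 then (\<lambda>u. f' (z + u) - f' (z - u))
      else (\<lambda>u. f'' (z + u) + f'' (z - u)))" for m :: nat
    have dD: "(D m has_real_derivative D (Suc m) t) (at t)" if "m < 2" for m t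
    proof -
      have plus: "((\<lambda>u. h (z + u)) has_real_derivative h' (z + t)) (at t)"
        and minus: "((\<lambda>u. h (z - u)) has_real_derivative - h' (z - t)) (at t)"
        if "\<And>x. (h has_real_derivative h' x) (at x)" for h h' :: "real \<Rightarrow> real"
        by (rule DERIV_cong[OF DERIV_chain2[OF that]], auto intro!: derivative_eq_intros)+
      have "m = 0 \<or> m = 1" using \<open>m < 2\<close> by auto
      then show ?thesis
        unfolding D_def \<psi>_def
        by (auto intro!: derivative_eq_intros plus[OF f'] minus[OF f'] plus[OF f''] minus[OF f''])
    qed
    have "\<exists>t. \<bar>t\<bar> \<le> \<bar>u\<bar> \<and> \<psi> u = (\<Sum>m<2. D m 0 / fact m * u ^ m) + D 2 t / fact 2 * u ^ 2"
      using dD by (intro Maclaurin_bi_le) (auto simp: D_def)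
    then obtain t where t: "\<bar>t\<bar> \<le> \<bar>u\<bar>" "\<psi> u = D 2 t / 2 * u\<^sup>2"
      by (auto simp: D_def \<psi>_def numeral_2_eq_2)
    have "\<bar>f'' (z + t) - C\<bar> < e" "\<bar>f'' (z - t) - C\<bar> < e" using t u by (auto intro!: \<rho>)
    moreover have "D 2 t = f'' (z + t) + f'' (z - t)" by (simp add: D_def)
    ultimately have "\<bar>D 2 t / 2 - C\<bar> \<le> e" by linarith
    then have "\<bar>D 2 t / 2 - C\<bar> * u\<^sup>2 \<le> e * u\<^sup>2" by (rule mult_right_mono) simp
    moreover have "\<psi> u - C * u\<^sup>2 = (D 2 t / 2 - C) * u\<^sup>2" by (simp add: t(2) algebra_simps)
    ultimately show ?thesis by (simp add: abs_mult)
  qed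
  define s where "s = \<rho> / (\<bar>R\<bar> + 1)"
  have "0 < s" using \<open>0 < \<rho>\<close> by (simp add: s_def)
  show "\<exists>g'. approximable \<sigma> g' \<and> (\<forall>x. \<bar>x\<bar> \<le> R \<longrightarrow> \<bar>g' x - x\<^sup>2\<bar> < \<epsilon>)"
  proof (intro exI conjI allI impI)
    \<comment> \<open>The constant \<open>f z\<close> is written as \<open>f (0 * x + z)\<close>, so
      that it too is an affine substitution into \<open>f\<close>.\<close>
    have "approximable \<sigma> (\<lambda>x. 1 / (s\<^sup>2 * C) * (f (s * x + z) + (f ((- s) * x + z) + (- 2) * f (0 * x + z))))"
      by (intro approximable_scale approximable_add approximable_affine f)
    moreover have "\<psi> (s * x) / (s\<^sup>2 * C) =
        1 / (s\<^sup>2 * C) * (f (s * x + z) + (f ((- s) * x + z) + (- 2) * f (0 * x + z)))" for x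
      by (simp add: \<psi>_def add.commute)
    ultimately show "approximable \<sigma> (\<lambda>x. \<psi> (s * x) / (s\<^sup>2 * C))" by presburger
    fix x :: real assume x: "\<bar>x\<bar> \<le> R"
    have "\<bar>s * x\<bar> < \<rho>"
    proof -
      have "s * \<bar>x\<bar> \<le> s * \<bar>R\<bar>" using x \<open>0 < s\<close> by (intro mult_left_mono) auto
      also have "\<dots> < s * (\<bar>R\<bar> + 1)" using \<open>0 < s\<close> by simp
      also have "\<dots> = \<rho>" unfolding s_def by (simp add: add_nonneg_eq_0_iff)
      finally show ?thesis using \<open>0 < s\<close> by (simp add: abs_mult)
    qed
    from taylor[OF this]
    have "\<bar>\<psi> (s * x) - C * (s * x)\<^sup>2\<bar> / (s\<^sup>2 * \<bar>C\<bar>) \<le> e * (s * x)\<^sup>2 / (s\<^sup>2 * \<bar>C\<bar>)"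
      by (rule divide_right_mono) simp
    also have "\<bar>\<psi> (s * x) - C * (s * x)\<^sup>2\<bar> / (s\<^sup>2 * \<bar>C\<bar>) = \<bar>(\<psi> (s * x) - C * (s * x)\<^sup>2) / (s\<^sup>2 * C)\<bar>"
      by (simp add: abs_mult)
    also have "(\<psi> (s * x) - C * (s * x)\<^sup>2) / (s\<^sup>2 * C) = \<psi> (s * x) / (s\<^sup>2 * C) - x\<^sup>2"
      using \<open>0 < s\<close> nz by (simp add: C_def field_simps power2_eq_square)
    also have "e * (s * x)\<^sup>2 / (s\<^sup>2 * \<bar>C\<bar>) = \<epsilon> * (x\<^sup>2 / (R\<^sup>2 + 1))"
      using \<open>0 < s\<close> nz by (simp add: e_def C_def power_mult_distrib)
    also have "\<dots> < \<epsilon> * 1"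
    proof (rule mult_strict_left_mono)
      have "x\<^sup>2 \<le> R\<^sup>2" using x by (metis abs_ge_zero power2_abs power_mono)
      then show "x\<^sup>2 / (R\<^sup>2 + 1) < 1" using \<open>0 < R\<^sup>2 + 1\<close> by simp
    qed fact
    finally show "\<bar>\<psi> (s * x) / (s\<^sup>2 * C) - x\<^sup>2\<bar> < \<epsilon>" by simp
  qed
qed

text \<open>The second difference of a twofold antiderivative of \<open>\<sigma>\<close> is an average of translates of
  \<open>\<sigma>\<close>, and its second derivative is the second difference of \<open>\<sigma>\<close>.\<close>

lemma approximable_square:
  fixes \<sigma> :: "real \<Rightarrow> real"
  assumes cont: "continuous_on UNIV \<sigma>" and non_affine: "\<not> (\<exists>a b. \<forall>x. \<sigma> x = a + b * x)"
  shows "approximable \<sigma> (\<lambda>x. x\<^sup>2)"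
proof -
  obtain z \<eta> where "0 < \<eta>" and nz: "\<sigma> (z + 2 * \<eta>) - 2 * \<sigma> (z + \<eta>) + \<sigma> z \<noteq> 0"
    using zero_second_difference_imp_affine[OF cont] non_affine by blast
  obtain F where F: "\<And>x. (F has_real_derivative \<sigma> x) (at x)"
    using continuous_imp_antiderivative[OF cont] by blast
  then have contF: "continuous_on UNIV F"
    by (meson DERIV_isCont continuous_at_imp_continuous_on)
  then obtain F2 where F2: "\<And>x. (F2 has_real_derivative F x) (at x)"
    using continuous_imp_antiderivative by blast
  have shift: "((\<lambda>x. h (x + c)) has_real_derivative h' (x + c)) (at x)"
    if "\<And>x. (h has_real_derivative h' x) (at x)" for h h' :: "real \<Rightarrow> real" and x c
    using that[of "x + c"] by (simp add: DERIV_shift)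
  define S where "S x = F (x + \<eta>) - F x" for x
  define G where "G x = F2 (x + \<eta>) - F2 x" for x
  define S' where "S' x = \<sigma> (x + \<eta>) - \<sigma> x" for x
  have S: "approximable \<sigma> S"
    unfolding S_def by (rule approximable_increment[OF approximable_self cont F \<open>0 < \<eta>\<close>])
  have dG: "(G has_real_derivative S x) (at x)" for x
    unfolding G_def S_def by (intro DERIV_diff shift[OF F2] F2)
  have dS: "(S has_real_derivative S' x) (at x)" for x
    unfolding S_def S'_def by (intro DERIV_diff shift[OF F] F)
  have contS: "continuous_on UNIV S"
    using dS by (meson DERIV_isCont continuous_at_imp_continuous_on)
  have "continuous_on UNIV (\<lambda>x. S' (x + \<eta>) - S' x)"
    unfolding S'_def by (intro continuous_intros continuous_on_compose2[OF cont]) auto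
  moreover have "S' (z + \<eta>) - S' z \<noteq> 0"
    using nz by (simp add: S'_def algebra_simps)
  ultimately show ?thesis
    by (intro approximable_square_if_C2[OF approximable_increment[OF S contS dG \<open>0 < \<eta>\<close>],
          of "\<lambda>x. S (x + \<eta>) - S x" "\<lambda>x. S' (x + \<eta>) - S' x" z]
        DERIV_diff shift[OF dG] dG shift[OF dS] dS)
qed

section \<open>Products computed by feedforward networks\<close>

text \<open>Hides width and weights, so that networks can be added like functions by placing their
  hidden layers side by side.\<close>

definition mlp_computes :: "(real \<Rightarrow> real) \<Rightarrow> nat \<Rightarrow> ((nat \<Rightarrow> real) \<Rightarrow> nat \<Rightarrow> real) \<Rightarrow> bool" where
  "mlp_computes \<sigma> dT f \<longleftrightarrow> (\<exists>m W1 b1 W2 b2. \<forall>x c. mlp \<sigma> dT m W1 b1 W2 b2 x c = f x c)"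

lemma mlp_computes_ridge:
  "mlp_computes \<sigma> dT (\<lambda>x c. \<sigma> ((\<Sum>a<dT. x a * l a) + \<beta>) * v c)"
  unfolding mlp_computes_def mlp_def
  by (intro exI[of _ 1] exI[of _ "\<lambda>a _. l a"] exI[of _ "\<lambda>_. \<beta>"] exI[of _ "\<lambda>_. v"] exI[of _ "\<lambda>_. 0"]) simp

lemma mlp_computes_zero: "mlp_computes \<sigma> dT (\<lambda>x c. 0)"
  unfolding mlp_computes_def mlp_def
  by (intro exI[of _ 0] exI[of _ "\<lambda>_ _. 0"] exI[of _ "\<lambda>_. 0"]) simp

lemma mlp_computes_add:
  assumes "mlp_computes \<sigma> dT f" "mlp_computes \<sigma> dT g"
  shows "mlp_computes \<sigma> dT (\<lambda>x c. f x c + g x c)"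
proof -
  obtain m W1 b1 W2 b2 where f: "\<And>x c. mlp \<sigma> dT m W1 b1 W2 b2 x c = f x c"
    using assms(1) unfolding mlp_computes_def by metis
  obtain m' W1' b1' W2' b2' where g: "\<And>x c. mlp \<sigma> dT m' W1' b1' W2' b2' x c = g x c"
    using assms(2) unfolding mlp_computes_def by metis
  let ?W1 = "\<lambda>a r. if r < m then W1 a r else W1' a (r - m)"
  let ?b1 = "\<lambda>r. if r < m then b1 r else b1' (r - m)"
  let ?W2 = "\<lambda>r c. if r < m then W2 r c else W2' (r - m) c"
  have "mlp \<sigma> dT (m + m') ?W1 ?b1 ?W2 (\<lambda>c. b2 c + b2' c) x c = f x c + g x c" for x c
  proof -
    have "(\<Sum>r<m + m'. \<sigma> ((\<Sum>a<dT. x a * ?W1 a r) + ?b1 r) * ?W2 r c) =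
        (\<Sum>r<m + m'. if r < m then \<sigma> ((\<Sum>a<dT. x a * W1 a r) + b1 r) * W2 r c
          else \<sigma> ((\<Sum>a<dT. x a * W1' a (r - m)) + b1' (r - m)) * W2' (r - m) c)"
      by (intro sum.cong) auto
    then show ?thesis
      unfolding f[symmetric] g[symmetric] mlp_def
      using sum_lessThan_append[of m "\<lambda>r. \<sigma> ((\<Sum>a<dT. x a * W1 a r) + b1 r) * W2 r c"
          "\<lambda>r. \<sigma> ((\<Sum>a<dT. x a * W1' a r) + b1' r) * W2' r c" m']
      by simp
  qed
  then show ?thesis unfolding mlp_computes_def by blast
qed

lemma mlp_computes_sum:
  assumes "finite S" "\<And>s. s \<in> S \<Longrightarrow> mlp_computes \<sigma> dT (f s)"
  shows "mlp_computes \<sigma> dT (\<lambda>x c. \<Sum>s\<in>S. f s x c)"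
  using assms
proof (induction S rule: finite_induct)
  case empty
  show ?case using mlp_computes_zero by simp
next
  case (insert s S)
  then have "mlp_computes \<sigma> dT (\<lambda>x c. f s x c + (\<Sum>s\<in>S. f s x c))"
    by (intro mlp_computes_add) simp_all
  then show ?case using insert by simp
qed

text \<open>Lifts a one-variable approximant to a function of the linear form given by
  \<open>l\<close>: the slopes \<open>a q\<close> go into the input weights, the coefficients
  \<open>u q\<close> into the output weights.\<close>

lemma mlp_computes_neuron_combination:
  fixes Q :: nat
  shows
  "mlp_computes \<sigma> dT (\<lambda>x c. (\<Sum>q<Q. u q * \<sigma> (a q * (\<Sum>r<dT. x r * l r) + b q)) * v c)"
proof -
  have "mlp_computes \<sigma> dT (\<lambda>x c. \<Sum>q<Q. \<sigma> ((\<Sum>r<dT. x r * (a q * l r)) + b q) * (u q * v c))"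
    by (intro mlp_computes_sum mlp_computes_ridge finite_lessThan)
  moreover have "(\<Sum>q<Q. \<sigma> ((\<Sum>r<dT. x r * (a q * l r)) + b q) * (u q * v c)) =
      (\<Sum>q<Q. u q * \<sigma> (a q * (\<Sum>r<dT. x r * l r) + b q)) * v c" for x c
    by (simp add: sum_distrib_left sum_distrib_right mult_ac)
  ultimately show ?thesis by simp
qed

text \<open>Products come from the square by polarisation, \<open>y e = ((y + e)\<^sup>2 - (y - e)\<^sup>2) / 4\<close>.\<close>

lemma mlp_approximates_products:
  fixes p q r :: "'s \<Rightarrow> nat" and \<epsilon> R :: real
  assumes sq: "approximable \<sigma> (\<lambda>x. x\<^sup>2)" and "finite S" "0 < \<epsilon>"
    and pq: "\<forall>s\<in>S. p s < dT \<and> q s < dT"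
  shows "\<exists>m W1 b1 W2 b2. \<forall>x. (\<forall>s\<in>S. \<bar>x (p s)\<bar> + \<bar>x (q s)\<bar> \<le> R) \<longrightarrow>
    (\<forall>c. \<bar>mlp \<sigma> dT m W1 b1 W2 b2 x c - (\<Sum>s\<in>S. if r s = c then x (p s) * x (q s) else 0)\<bar> \<le> card S * \<epsilon>)"
proof -
  obtain Q u a b where approx: "\<And>x. \<bar>x\<bar> \<le> R \<Longrightarrow>
      \<bar>(\<Sum>q<(Q::nat). u q * \<sigma> (a q * x + b q)) - x\<^sup>2\<bar> < \<epsilon>"
    using approximableE[OF sq \<open>0 < \<epsilon>\<close>] by metis
  define \<phi> where "\<phi> x = (\<Sum>q<Q. u q * \<sigma> (a q * x + b q))" for x
  \<comment> \<open>Adding two indicators, instead of distinguishing cases, keeps the coefficients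
    right even if \<open>p s = q s\<close>.\<close>
  have form: "(\<Sum>z<dT. x z * ((if z = p s then 1 else 0) + \<tau> * (if z = q s then 1 else 0))) = x (p s) + \<tau> * x (q s)"
    if "s \<in> S" for s \<tau> and x :: "nat \<Rightarrow> real"
  proof -
    have "(\<Sum>z<dT. x z * ((if z = p s then 1 else 0) + \<tau> * (if z = q s then 1 else 0))) =
        (\<Sum>z<dT. if z = p s then x z else 0) + (\<Sum>z<dT. if z = q s then \<tau> * x z else 0)"
      unfolding sum.distrib[symmetric] by (intro sum.cong) (auto simp: algebra_simps)
    also have "\<dots> = x (p s) + \<tau> * x (q s)" using pq that by simp
    finally show ?thesis .
  qed
  have ridge: "mlp_computes \<sigma> dT (\<lambda>x c. \<phi> (x (p s) + \<tau> * x (q s)) * v c)" if "s \<in> S" for s \<tau> v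
    using mlp_computes_neuron_combination[of \<sigma> dT u a
        "\<lambda>z. (if z = p s then 1 else 0) + \<tau> * (if z = q s then 1 else 0)" b Q v]
    unfolding form[OF that] \<phi>_def .
  have "mlp_computes \<sigma> dT (\<lambda>x c. \<Sum>s\<in>S. \<phi> (x (p s) + 1 * x (q s)) * (if r s = c then 1 / 4 else 0)
      + \<phi> (x (p s) + (- 1) * x (q s)) * (if r s = c then - 1 / 4 else 0))"
    by (intro mlp_computes_sum mlp_computes_add ridge \<open>finite S\<close>)
  then obtain m W1 b1 W2 b2 where mlp: "\<And>x c. mlp \<sigma> dT m W1 b1 W2 b2 x c =
      (\<Sum>s\<in>S. \<phi> (x (p s) + 1 * x (q s)) * (if r s = c then 1 / 4 else 0)
      + \<phi> (x (p s) + (- 1) * x (q s)) * (if r s = c then - 1 / 4 else 0))"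
    unfolding mlp_computes_def by blast
  show ?thesis
  proof (intro exI allI impI)
    fix x c assume R: "\<forall>s\<in>S. \<bar>x (p s)\<bar> + \<bar>x (q s)\<bar> \<le> R"
    have "\<bar>\<phi> (x (p s) + 1 * x (q s)) * (if r s = c then 1 / 4 else 0)
      + \<phi> (x (p s) + (- 1) * x (q s)) * (if r s = c then - 1 / 4 else 0)
      - (if r s = c then x (p s) * x (q s) else 0)\<bar> \<le> \<epsilon>" if "s \<in> S" for s
    proof -
      let ?y = "x (p s)" and ?e = "x (q s)"
      have "\<bar>?y + ?e\<bar> \<le> R" "\<bar>?y - ?e\<bar> \<le> R" using R that by force+
      then have "\<bar>\<phi> (?y + ?e) - (?y + ?e)\<^sup>2\<bar> < \<epsilon>" "\<bar>\<phi> (?y - ?e) - (?y - ?e)\<^sup>2\<bar> < \<epsilon>"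
        using approx unfolding \<phi>_def by blast+
      moreover have "(?y + ?e)\<^sup>2 - (?y - ?e)\<^sup>2 = 4 * (?y * ?e)"
        by (simp add: power2_eq_square algebra_simps)
      ultimately have "\<bar>\<phi> (?y + ?e) / 4 - \<phi> (?y - ?e) / 4 - ?y * ?e\<bar> \<le> \<epsilon>" by linarith
      then show ?thesis using \<open>0 < \<epsilon>\<close> by simp
    qed
    then have "\<bar>\<Sum>s\<in>S. \<phi> (x (p s) + 1 * x (q s)) * (if r s = c then 1 / 4 else 0)
      + \<phi> (x (p s) + (- 1) * x (q s)) * (if r s = c then - 1 / 4 else 0)
      - (if r s = c then x (p s) * x (q s) else 0)\<bar> \<le> (\<Sum>s\<in>S. \<epsilon>)"
      by (intro order_trans[OF sum_abs] sum_mono)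
    then show "\<bar>mlp \<sigma> dT m W1 b1 W2 b2 x c - (\<Sum>s\<in>S. if r s = c then x (p s) * x (q s) else 0)\<bar> \<le> card S * \<epsilon>"
      unfolding mlp by (simp only: sum_subtractf sum_constant)
  qed
qed

section \<open>Index equivalence classes\<close>

text \<open>Canonical representatives of equality patterns: read from the right, every new value is the
  least unused number, so that \<open>{..<m}\<close> is the set of values.\<close>

fun growth_lists :: "nat \<Rightarrow> nat \<Rightarrow> nat list set" where
  "growth_lists 0 0 = {[]}"
| "growth_lists 0 (Suc m) = {}"
| "growth_lists (Suc l) 0 = {}"
| "growth_lists (Suc l) (Suc m) =
     (\<lambda>(a, xs). a # xs) ` ({..m} \<times> growth_lists l (Suc m)) \<union> (#) m ` growth_lists l m"

text \<open>The two sets in the recursive clause match the two summands in the recursion of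
  \<open>Stirling\<close>. An upper bound is enough, because heads may be left over.\<close>

lemma finite_card_growth_lists:
  "finite (growth_lists l m) \<and> card (growth_lists l m) \<le> Stirling l m"
proof (induction l m rule: growth_lists.induct)
  case (4 l m)
  let ?A = "(\<lambda>(a, xs). a # xs) ` ({..m} \<times> growth_lists l (Suc m))" and ?B = "(#) m ` growth_lists l m"
  have "card ?A \<le> Suc m * card (growth_lists l (Suc m))"
    using card_image_le[of "{..m} \<times> growth_lists l (Suc m)" "\<lambda>(a, xs). a # xs"] 4
    by (simp add: card_cartesian_product)
  also have "\<dots> \<le> Suc m * Stirling l (Suc m)" using 4 by (intro mult_left_mono) auto
  finally have A: "card ?A \<le> Suc m * Stirling l (Suc m)" .
  have B: "card ?B \<le> Stirling l m" using 4 card_image_le[of "growth_lists l m" "(#) m"] by auto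
  have "card (?A \<union> ?B) \<le> card ?A + card ?B" by (rule card_Un_le)
  with A B have "card (?A \<union> ?B) \<le> Stirling (Suc l) (Suc m)" by simp
  then show ?case using 4 by simp
qed auto

lemma growth_lists_set: "xs \<in> growth_lists l m \<Longrightarrow> set xs \<subseteq> {..<m} \<and> length xs = l \<and> m \<le> l"
proof (induction l m arbitrary: xs rule: growth_lists.induct)
  case (4 l m)
  then show ?case by fastforce
qed auto

text \<open>The last clause carries the induction: it tells whether the new head of the list reuses
  a label below \<open>m\<close> or receives the fresh label \<open>m\<close>.\<close>

lemma obtain_growth_list:
  fixes ys :: "nat list"
  obtains m xs f where "xs \<in> growth_lists (length ys) m" "inj_on f {..<m}" "ys = map f xs"
    "f ` {..<m} = set ys"
proof -
  have "\<exists>m xs f. xs \<in> growth_lists (length ys) m \<and> inj_on f {..<m} \<and> ys = map f xs \<and> f ` {..<m} = set ys"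
  proof (induction ys)
    case Nil
    have "[] \<in> growth_lists (length []) 0" by simp
    then show ?case by (intro exI[of _ 0] exI[of _ "[]"]) auto
  next
    case (Cons a ys)
    then obtain m xs f where IH: "xs \<in> growth_lists (length ys) m" "inj_on f {..<m}" "ys = map f xs"
      "f ` {..<m} = set ys"
      by blast
    show ?case
    proof (cases "a \<in> set ys")
      case True
      then obtain c where c: "c < m" "a = f c" using IH(4) by (metis imageE lessThan_iff)
      then obtain m' where m': "m = Suc m'" by (cases m) auto
      then have "c # xs \<in> growth_lists (length (a # ys)) m" using IH(1) c by auto
      then show ?thesis using IH c True by (intro exI[of _ m] exI[of _ "c # xs"] exI[of _ f]) auto
    next
      case False
      have xs: "set xs \<subseteq> {..<m}" using growth_lists_set[OF IH(1)] by simp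
      have "m # xs \<in> growth_lists (length (a # ys)) (Suc m)" using IH(1) by auto
      moreover have "inj_on (f(m := a)) {..<Suc m}"
        using IH(2,4) False by (auto simp: inj_on_def lessThan_Suc)
      moreover have "map (f(m := a)) xs = map f xs" using xs by (intro map_cong) auto
      moreover have "f(m := a) ` {..<Suc m} = set (a # ys)"
        using IH(4) by (auto simp: lessThan_Suc)
      moreover have "a # ys = map (f(m := a)) (m # xs)" using calculation(3) IH(3) by simp
      ultimately show ?thesis by (metis (no_types))
    qed
  qed
  then show thesis using that by blast
qed

section \<open>Permutation classes as equality patterns\<close>

lemma bij_betw_extends_to_permutation:
  assumes "finite S" "A \<subseteq> S" "B \<subseteq> S" "bij_betw f A B"
  obtains \<pi> where "\<pi> permutes S" "\<And>x. x \<in> A \<Longrightarrow> \<pi> x = f x"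
proof -
  have "card (S - A) = card (S - B)"
    using assms bij_betw_same_card[OF assms(4)] by (simp add: card_Diff_subset finite_subset)
  then obtain g where g: "bij_betw g (S - A) (S - B)"
    using assms(1) finite_same_card_bij[of "S - A" "S - B"] by auto
  define \<pi> where "\<pi> x = (if x \<in> A then f x else if x \<in> S then g x else x)" for x
  have "bij_betw \<pi> A B" using assms(4) by (rule bij_betw_cong[THEN iffD1, rotated]) (auto simp: \<pi>_def)
  moreover have "bij_betw \<pi> (S - A) (S - B)"
    using g by (rule bij_betw_cong[THEN iffD1, rotated]) (auto simp: \<pi>_def)
  ultimately have "bij_betw \<pi> (A \<union> (S - A)) (B \<union> (S - B))"
    by (rule bij_betw_combine) auto
  then have "bij_betw \<pi> S S" using assms(2,3) by (simp add: Un_absorb1)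
  then have "\<pi> permutes S" using assms(2) by (intro bij_imp_permutes) (auto simp: \<pi>_def)
  then show thesis using that by (simp add: \<pi>_def)
qed

lemma finite_idx: "finite (idx n l)"
  unfolding idx_def using finite_lists_length_eq[of "{..<n}" l] by (simp add: conj_commute)

lemma map_permutes_idx: "\<pi> permutes {..<n} \<Longrightarrow> map \<pi> i \<in> idx n l \<longleftrightarrow> i \<in> idx n l"
  unfolding idx_def using permutes_in_image[of \<pi> "{..<n}"] by auto

lemma nth_idx_less: "i \<in> idx n k \<Longrightarrow> p < k \<Longrightarrow> i ! p < n"
  by (auto simp: idx_def subset_iff)

lemma append_idx_iff: "length i = k \<Longrightarrow> i @ j \<in> idx n (k + l) \<longleftrightarrow> i \<in> idx n k \<and> j \<in> idx n l"
  unfolding idx_def by auto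

lemma sim_relI: "\<pi> permutes {..<n} \<Longrightarrow> j \<in> idx n l \<Longrightarrow> (map \<pi> j, j) \<in> sim_rel n l"
  unfolding sim_rel_def by (auto simp: map_permutes_idx)

text \<open>Two injective relabellings of one list differ by a bijection between subsets of
  \<open>{..<n}\<close>, and this extends to a permutation.\<close>

lemma sim_rel_if_common_pattern:
  assumes "map f xs \<in> idx n l" "map g xs \<in> idx n l" "inj_on f (set xs)" "inj_on g (set xs)"
  shows "(map f xs, map g xs) \<in> sim_rel n l"
proof -
  let ?h = "f \<circ> the_inv_into (set xs) g"
  have "bij_betw ?h (g ` set xs) (f ` set xs)"
    using assms(3,4) by (intro bij_betw_trans[OF bij_betw_the_inv_into]) (auto simp: bij_betw_def)
  then obtain \<pi> where \<pi>: "\<pi> permutes {..<n}" "\<And>x. x \<in> g ` set xs \<Longrightarrow> \<pi> x = ?h x"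
    using bij_betw_extends_to_permutation[of "{..<n}" "g ` set xs" "f ` set xs" ?h] assms(1,2)
    by (auto simp: idx_def)
  have "map f xs = map \<pi> (map g xs)"
    using \<pi>(2) assms(4) by (auto simp: the_inv_into_f_f)
  then show ?thesis using sim_relI[OF \<pi>(1) assms(2)] by metis
qed

lemma equiv_sim_rel: "equiv (idx n l) (sim_rel n l)"
proof (rule equivI)
  show "sim_rel n l \<subseteq> idx n l \<times> idx n l" unfolding sim_rel_def by auto
  show "refl_on (idx n l) (sim_rel n l)"
    using sim_relI[OF permutes_id, of _ n l] by (auto simp: refl_on_def)
  show "sym (sim_rel n l)"
  proof (rule symI)
    fix i j assume "(i, j) \<in> sim_rel n l"
    then obtain \<pi> where \<pi>: "i \<in> idx n l" "\<pi> permutes {..<n}" "i = map \<pi> j" unfolding sim_rel_def by auto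
    then have "j = map (inv \<pi>) i" by (simp add: permutes_inv_o comp_def permutes_inverses)
    then show "(j, i) \<in> sim_rel n l" using sim_relI[OF permutes_inv[OF \<pi>(2)] \<pi>(1)] by simp
  qed
  show "trans (sim_rel n l)"
  proof (rule transI)
    fix x y z assume "(x, y) \<in> sim_rel n l" "(y, z) \<in> sim_rel n l"
    then obtain \<pi> \<pi>' where "\<pi> permutes {..<n}" "x = map \<pi> y" "\<pi>' permutes {..<n}" "y = map \<pi>' z" "z \<in> idx n l"
      unfolding sim_rel_def by auto
    then show "(x, z) \<in> sim_rel n l" using sim_relI[OF permutes_compose[of \<pi>' _ \<pi>], of n z l] by simp
  qed
qed

lemma finite_eq_classes: "finite (eq_classes n l)"
  unfolding eq_classes_def using finite_idx equiv_sim_rel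
  by (intro finite_quotient) (auto simp: equiv_def)

lemma class_of_in_eq_classes: "i \<in> idx n l \<Longrightarrow> class_of n l i \<in> eq_classes n l"
  unfolding class_of_def eq_classes_def by (rule quotientI)

lemma self_in_class_of: "i \<in> idx n l \<Longrightarrow> i \<in> class_of n l i"
  unfolding class_of_def by (rule equiv_class_self[OF equiv_sim_rel])

lemma eq_classes_subset_idx: "\<gamma> \<in> eq_classes n l \<Longrightarrow> \<gamma> \<subseteq> idx n l"
  unfolding eq_classes_def by (rule in_quotient_imp_subset[OF equiv_sim_rel])

lemma eq_classes_nonempty: "\<gamma> \<in> eq_classes n l \<Longrightarrow> \<gamma> \<noteq> {}"
  unfolding eq_classes_def by (rule in_quotient_imp_non_empty[OF equiv_sim_rel])

lemma eq_class_eq_class_of: "\<gamma> \<in> eq_classes n l \<Longrightarrow> i \<in> \<gamma> \<Longrightarrow> class_of n l i = \<gamma>"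
  unfolding eq_classes_def class_of_def
  using equiv_sim_rel by (metis Image_singleton_iff equiv_class_eq_iff quotientE)

lemma class_of_eq_iff:
  "i \<in> idx n l \<Longrightarrow> j \<in> idx n l \<Longrightarrow> class_of n l i = class_of n l j \<longleftrightarrow> (i, j) \<in> sim_rel n l"
  unfolding class_of_def by (rule eq_equiv_class_iff[OF equiv_sim_rel])

text \<open>Trades the permutation for equalities between positions, which are what inner products
  of rows of \<open>P\<close> can detect.\<close>

lemma sim_rel_iff_same_equalities:
  assumes "i \<in> idx n l" "j \<in> idx n l"
  shows "(i, j) \<in> sim_rel n l \<longleftrightarrow> (\<forall>p<l. \<forall>q<l. i ! p = i ! q \<longleftrightarrow> j ! p = j ! q)"
proof
  have len: "length i = l" "length j = l" using assms by (auto simp: idx_def)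
  { assume "(i, j) \<in> sim_rel n l"
    then obtain \<pi> where "\<pi> permutes {..<n}" "i = map \<pi> j" unfolding sim_rel_def by auto
    then show "\<forall>p<l. \<forall>q<l. i ! p = i ! q \<longleftrightarrow> j ! p = j ! q"
      using len by (auto simp: inj_eq permutes_inj) }
  assume eq: "\<forall>p<l. \<forall>q<l. i ! p = i ! q \<longleftrightarrow> j ! p = j ! q"
  obtain m xs f where xs: "xs \<in> growth_lists (length j) m" "inj_on f {..<m}" "j = map f xs"
    using obtain_growth_list[of j] by metis
  \<comment> \<open>Any position at which \<open>j\<close> has the value \<open>y\<close>. By
    \<open>eq\<close> the entry of \<open>i\<close> there does not depend on the choice, so
    \<open>y\<close> is relabelled consistently.\<close>
  define pos where "pos y = (SOME p. p < l \<and> j ! p = y)" for y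
  have pos: "pos (j ! p) < l \<and> j ! pos (j ! p) = j ! p" if "p < l" for p
    unfolding pos_def by (rule someI[of _ p]) (use that in simp)
  have "i = map (\<lambda>y. i ! pos y) j"
    using len pos eq by (intro nth_equalityI) auto
  moreover have "inj_on (\<lambda>y. i ! pos y) (set j)"
  proof (rule inj_onI)
    fix y y' assume "y \<in> set j" "y' \<in> set j" and yy: "i ! pos y = i ! pos y'"
    then obtain p p' where "p < l" "y = j ! p" "p' < l" "y' = j ! p'" using len by (metis in_set_conv_nth)
    then show "y = y'" using pos eq yy by metis
  qed
  ultimately show "(i, j) \<in> sim_rel n l"
    using sim_rel_if_common_pattern[of "\<lambda>y. i ! pos y" j n l id] assms by simp
qed

text \<open>Every class contains an injective relabelling of some canonical list, and classes
  sharing this list coincide. Choosing one list per class is therefore injective.\<close>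

lemma card_eq_classes_le_bell: "card (eq_classes n l) \<le> bell l"
proof -
  have "\<exists>xs f. xs \<in> (\<Union>m\<le>l. growth_lists l m) \<and> inj_on f (set xs) \<and> map f xs \<in> \<gamma>"
    if \<gamma>: "\<gamma> \<in> eq_classes n l" for \<gamma>
  proof -
    obtain ys where ys: "ys \<in> \<gamma>" "length ys = l"
      using eq_classes_nonempty[OF \<gamma>] eq_classes_subset_idx[OF \<gamma>] by (auto simp: idx_def)
    obtain m xs f where "xs \<in> growth_lists l m" "inj_on f {..<m}" "ys = map f xs"
      using obtain_growth_list[of ys] ys(2) by metis
    moreover from this have "inj_on f (set xs)" "m \<le> l"
      using growth_lists_set inj_on_subset by metis+
    ultimately show ?thesis using ys by blast
  qed
  then obtain xs f where xf: "\<And>\<gamma>. \<gamma> \<in> eq_classes n l \<Longrightarrow> xs \<gamma> \<in> (\<Union>m\<le>l. growth_lists l m) \<and>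
      inj_on (f \<gamma>) (set (xs \<gamma>)) \<and> map (f \<gamma>) (xs \<gamma>) \<in> \<gamma>"
    by metis
  have "inj_on xs (eq_classes n l)"
  proof (rule inj_onI)
    fix \<gamma> \<gamma>' assume \<gamma>: "\<gamma> \<in> eq_classes n l" "\<gamma>' \<in> eq_classes n l" and eq: "xs \<gamma> = xs \<gamma>'"
    let ?i = "map (f \<gamma>) (xs \<gamma>)" and ?j = "map (f \<gamma>') (xs \<gamma>)"
    have ij: "?i \<in> \<gamma>" "?j \<in> \<gamma>'" using xf[OF \<gamma>(1)] xf[OF \<gamma>(2)] eq by auto
    then have "?i \<in> idx n l" "?j \<in> idx n l" using eq_classes_subset_idx \<gamma> by blast+
    moreover from this have "(?i, ?j) \<in> sim_rel n l"
      using xf[OF \<gamma>(1)] xf[OF \<gamma>(2)] eq by (intro sim_rel_if_common_pattern) auto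
    ultimately show "\<gamma> = \<gamma>'" using class_of_eq_iff eq_class_eq_class_of \<gamma> ij by metis
  qed
  moreover have fin: "finite (\<Union>m\<le>l. growth_lists l m)" using finite_card_growth_lists by auto
  ultimately have "card (eq_classes n l) \<le> card (\<Union>m\<le>l. growth_lists l m)"
    using xf by (intro card_inj_on_le[of xs]) auto
  also have "\<dots> \<le> (\<Sum>m\<le>l. card (growth_lists l m))" by (rule card_UN_le) simp
  also have "\<dots> \<le> bell l" unfolding bell_def by (intro sum_mono) (simp add: finite_card_growth_lists)
  finally show ?thesis .
qed

text \<open>Splits membership in \<open>\<mu>\<close> by what can test it: the type of
  \<open>i\<close> is left to the feedforward network, while the type of \<open>j\<close> and the
  cross equalities enter the score.\<close>

definition class_pattern :: "nat \<Rightarrow> nat \<Rightarrow> nat list set \<Rightarrow> nat list \<Rightarrow> nat list \<Rightarrow> bool" where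
  "class_pattern n k \<mu> r1 r2 \<longleftrightarrow> r1 \<in> idx n k \<and> r2 \<in> idx n k \<and> r1 @ r2 \<in> \<mu> \<and>
    (\<forall>i\<in>idx n k. \<forall>j\<in>idx n k. i @ j \<in> \<mu> \<longleftrightarrow>
       class_of n k i = class_of n k r1 \<and> class_of n k j = class_of n k r2 \<and>
       (\<forall>p<k. \<forall>q<k. i ! p = j ! q \<longleftrightarrow> r1 ! p = r2 ! q))"

text \<open>Equalities between positions of \<open>i @ j\<close> lie inside \<open>i\<close>, inside
  \<open>j\<close>, or across the two. The first two kinds amount to the order-k types of
  \<open>i\<close> and \<open>j\<close>.\<close>

lemma class_pattern_exists:
  assumes \<mu>: "\<mu> \<in> eq_classes n (2 * k)"
  shows "\<exists>r1 r2. class_pattern n k \<mu> r1 r2"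
proof -
  obtain r where "r \<in> \<mu>" using eq_classes_nonempty[OF \<mu>] by blast
  define r1 r2 where "r1 = take k r" and "r2 = drop k r"
  have r: "r1 @ r2 \<in> \<mu>" using \<open>r \<in> \<mu>\<close> by (simp add: r1_def r2_def)
  then have r_idx: "r1 @ r2 \<in> idx n (k + k)" using eq_classes_subset_idx[OF \<mu>] by (auto simp: mult_2)
  moreover have "length r1 = k" using \<open>r \<in> \<mu>\<close> eq_classes_subset_idx[OF \<mu>] by (auto simp: idx_def r1_def)
  ultimately have r12: "r1 \<in> idx n k" "r2 \<in> idx n k" using append_idx_iff by blast+
  have "i @ j \<in> \<mu> \<longleftrightarrow> class_of n k i = class_of n k r1 \<and> class_of n k j = class_of n k r2 \<and>
       (\<forall>p<k. \<forall>q<k. i ! p = j ! q \<longleftrightarrow> r1 ! p = r2 ! q)"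
    if i: "i \<in> idx n k" and j: "j \<in> idx n k" for i j
  proof -
    have len: "length i = k" "length j = k" "length r1 = k" "length r2 = k"
      using i j r12 by (auto simp: idx_def)
    have ij: "i @ j \<in> idx n (2 * k)" and rr: "r1 @ r2 \<in> idx n (2 * k)"
      using i j r_idx len append_idx_iff[of i k j n k] by (auto simp: mult_2)
    have "i @ j \<in> \<mu> \<longleftrightarrow> (i @ j, r1 @ r2) \<in> sim_rel n (2 * k)"
      using eq_class_eq_class_of[OF \<mu>] r class_of_eq_iff[OF ij rr] self_in_class_of[OF ij] by metis
    also have "\<dots> \<longleftrightarrow> (\<forall>p<k + k. \<forall>q<k + k. (i @ j) ! p = (i @ j) ! q \<longleftrightarrow> (r1 @ r2) ! p = (r1 @ r2) ! q)"
      using sim_rel_iff_same_equalities[OF ij rr] by (simp add: mult_2)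
    also have "\<dots> \<longleftrightarrow> (\<forall>p<k. \<forall>q<k. (i ! p = i ! q \<longleftrightarrow> r1 ! p = r1 ! q) \<and> (j ! p = j ! q \<longleftrightarrow> r2 ! p = r2 ! q) \<and>
        (i ! p = j ! q \<longleftrightarrow> r1 ! p = r2 ! q))" (is "?L = ?R")
    proof
      assume L: ?L
      show ?R
      proof (intro allI impI)
        fix p q assume pq: "p < k" "q < k"
        have "p < k + k" "q < k + k" "k + p < k + k" "k + q < k + k" using pq by auto
        then have "(i @ j) ! p = (i @ j) ! q \<longleftrightarrow> (r1 @ r2) ! p = (r1 @ r2) ! q"
          "(i @ j) ! p = (i @ j) ! (k + q) \<longleftrightarrow> (r1 @ r2) ! p = (r1 @ r2) ! (k + q)"
          "(i @ j) ! (k + p) = (i @ j) ! (k + q) \<longleftrightarrow> (r1 @ r2) ! (k + p) = (r1 @ r2) ! (k + q)"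
          using L by blast+
        then show "(i ! p = i ! q \<longleftrightarrow> r1 ! p = r1 ! q) \<and> (j ! p = j ! q \<longleftrightarrow> r2 ! p = r2 ! q) \<and>
            (i ! p = j ! q \<longleftrightarrow> r1 ! p = r2 ! q)"
          using pq len by (simp add: nth_append)
      qed
    next
      assume R: ?R
      show ?L
      proof (intro allI impI)
        fix p q assume "p < k + k" "q < k + k"
        then have "\<not> p < k \<Longrightarrow> p - k < k" "\<not> q < k \<Longrightarrow> q - k < k" by auto
        then show "(i @ j) ! p = (i @ j) ! q \<longleftrightarrow> (r1 @ r2) ! p = (r1 @ r2) ! q"
          unfolding nth_append len using R by (cases "p < k"; cases "q < k") (auto simp: eq_commute)
      qed
    qed
    also have "\<dots> \<longleftrightarrow> class_of n k i = class_of n k r1 \<and> class_of n k j = class_of n k r2 \<and>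
       (\<forall>p<k. \<forall>q<k. i ! p = j ! q \<longleftrightarrow> r1 ! p = r2 ! q)"
      unfolding class_of_eq_iff[OF i r12(1)] class_of_eq_iff[OF j r12(2)]
        sim_rel_iff_same_equalities[OF i r12(1)] sim_rel_iff_same_equalities[OF j r12(2)]
      by (simp only: imp_conjR all_conj_distrib)
    finally show ?thesis .
  qed
  then show ?thesis unfolding class_pattern_def using r r12 by blast
qed

section \<open>Counting the tokens that complete an index to a class member\<close>

lemma map_permutes_in_eq_class:
  assumes "\<mu> \<in> eq_classes n l" "\<pi> permutes {..<n}" "i \<in> \<mu>"
  shows "map \<pi> i \<in> \<mu>"
proof -
  have i: "i \<in> idx n l" using eq_classes_subset_idx assms by blast
  then have "(map \<pi> i, i) \<in> sim_rel n l" by (rule sim_relI[OF assms(2)])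
  moreover have "map \<pi> i \<in> idx n l" using i assms(2) by (simp add: map_permutes_idx)
  ultimately show ?thesis
    using class_of_eq_iff i self_in_class_of eq_class_eq_class_of assms by metis
qed

text \<open>The permutation that carries \<open>i\<close> to \<open>i'\<close> also carries
  completions of \<open>i\<close> injectively to completions of \<open>i'\<close>.\<close>

lemma card_completions_le:
  assumes \<mu>: "\<mu> \<in> eq_classes n (k + l)" and "(i', i) \<in> sim_rel n k"
  shows "card {j \<in> idx n l. i @ j \<in> \<mu>} \<le> card {j \<in> idx n l. i' @ j \<in> \<mu>}"
proof -
  obtain \<pi> where \<pi>: "\<pi> permutes {..<n}" "i' = map \<pi> i" using assms(2) unfolding sim_rel_def by auto
  show ?thesis
  proof (rule card_inj_on_le[of "map \<pi>"])
    show "inj_on (map \<pi>) {j \<in> idx n l. i @ j \<in> \<mu>}"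
      by (rule inj_on_subset[OF inj_mapI[OF permutes_inj[OF \<pi>(1)]]]) simp
    show "map \<pi> ` {j \<in> idx n l. i @ j \<in> \<mu>} \<subseteq> {j \<in> idx n l. i' @ j \<in> \<mu>}"
      using map_permutes_in_eq_class[OF \<mu> \<pi>(1)] \<pi> by (force simp: map_permutes_idx)
  qed (simp add: finite_idx)
qed

lemma card_completions_eq:
  assumes "\<mu> \<in> eq_classes n (k + l)" "i \<in> idx n k" "i' \<in> idx n k" "class_of n k i = class_of n k i'"
  shows "card {j \<in> idx n l. i @ j \<in> \<mu>} = card {j \<in> idx n l. i' @ j \<in> \<mu>}"
proof -
  have "(i, i') \<in> sim_rel n k" "(i', i) \<in> sim_rel n k" 
    using class_of_eq_iff[OF assms(2,3)] class_of_eq_iff[OF assms(3,2)] assms(4) by auto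
  then show ?thesis using card_completions_le[OF assms(1)] by (simp add: order_antisym)
qed

text \<open>\<open>m - s\<close> counts the pairs \<open>p, q\<close> at which the patterns
  disagree, plus one if \<open>C\<close> fails. Being a count, it is at least 1 as soon as it is
  nonzero.\<close>

lemma pattern_score_gap:
  fixes i j r1 r2 :: "nat list" and C :: bool and k :: nat
  defines "s \<equiv> (\<Sum>p<k. \<Sum>q<k. (if r1 ! p = r2 ! q then 1 else - 1) * (if i ! p = j ! q then 1 else (0::real)))
      + (if C then 1 else 0)"
    and "m \<equiv> (\<Sum>p<k. \<Sum>q<k. if r1 ! p = r2 ! q then 1 else (0::real)) + 1"
  shows "C \<and> (\<forall>p<k. \<forall>q<k. i ! p = j ! q \<longleftrightarrow> r1 ! p = r2 ! q) \<Longrightarrow> s = m"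
    and "\<not> (C \<and> (\<forall>p<k. \<forall>q<k. i ! p = j ! q \<longleftrightarrow> r1 ! p = r2 ! q)) \<Longrightarrow> s \<le> m - 1"
proof -
  let ?f = "\<lambda>p q. if i ! p = j ! q \<longleftrightarrow> r1 ! p = r2 ! q then 0 else (1::real)"
  have ms: "m - s = (\<Sum>p<k. \<Sum>q<k. ?f p q) + (if C then 0 else 1)"
  proof -
    have "(\<Sum>p<k. \<Sum>q<k. if r1 ! p = r2 ! q then 1 else (0::real))
        - (\<Sum>p<k. \<Sum>q<k. (if r1 ! p = r2 ! q then 1 else - 1) * (if i ! p = j ! q then 1 else (0::real)))
        = (\<Sum>p<k. \<Sum>q<k. ?f p q)"
      unfolding sum_subtractf[symmetric] by (intro sum.cong refl) auto
    then show ?thesis unfolding m_def s_def by auto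
  qed
  { assume *: "C \<and> (\<forall>p<k. \<forall>q<k. i ! p = j ! q \<longleftrightarrow> r1 ! p = r2 ! q)"
    have "(\<Sum>p<k. \<Sum>q<k. ?f p q) = 0" using * by (intro sum.neutral ballI) auto
    then show "s = m" using ms * by simp }
  assume *: "\<not> (C \<and> (\<forall>p<k. \<forall>q<k. i ! p = j ! q \<longleftrightarrow> r1 ! p = r2 ! q))"
  have nonneg: "0 \<le> (\<Sum>q<k. ?f p q)" for p by (intro sum_nonneg) auto
  show "s \<le> m - 1"
  proof (cases C)
    case True
    then obtain p q where pq: "p < k" "q < k" "\<not> (i ! p = j ! q \<longleftrightarrow> r1 ! p = r2 ! q)" using * by blast
    have "1 = ?f p q" using pq by simp
    also have "\<dots> \<le> (\<Sum>q<k. ?f p q)" using pq by (intro member_le_sum) auto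
    also have "\<dots> \<le> (\<Sum>p<k. \<Sum>q<k. ?f p q)" using pq nonneg by (intro member_le_sum) auto
    finally show ?thesis using ms True by simp
  next
    case False
    have "0 \<le> (\<Sum>p<k. \<Sum>q<k. ?f p q)" by (intro sum_nonneg nonneg)
    then show ?thesis using ms False by simp
  qed
qed

section \<open>Softmax attention\<close>

text \<open>Once \<open>exp (t * m)\<close> is cancelled, each \<open>j\<close> in \<open>J\<close>
  has weight 1 and every other one at most \<open>exp (- t)\<close>. The normaliser is thus
  \<open>card J + \<rho>\<close> with \<open>\<rho>\<close> at most
  \<open>card N * exp (- t)\<close>.\<close>

lemma softmax_concentrates:
  fixes q :: "'a \<Rightarrow> real"
  assumes "finite N" and J: "J \<subseteq> N" "J \<noteq> {}"
    and on: "\<And>j. j \<in> J \<Longrightarrow> q j = m" and off: "\<And>j. j \<in> N - J \<Longrightarrow> q j \<le> m - 1"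
    and "0 \<le> t" "j \<in> N"
  shows "\<bar>exp (t * q j) / (\<Sum>j'\<in>N. exp (t * q j')) - (if j \<in> J then 1 / card J else 0)\<bar> \<le> card N * exp (- t)"
proof -
  define e where "e j = exp (t * (q j - m))" for j
  have e_on: "e j = 1" if "j \<in> J" for j using on[OF that] by (simp add: e_def)
  have e_off: "e j \<le> exp (- t)" if "j \<in> N - J" for j
    using mult_left_mono[OF off[OF that] \<open>0 \<le> t\<close>] by (simp add: e_def algebra_simps)
  have e_pos: "0 < e j" for j by (simp add: e_def)
  have "finite J" using J \<open>finite N\<close> finite_subset by blast
  then have cJ: "1 \<le> real (card J)" using J card_gt_0_iff[of J] by linarith
  define \<rho> where "\<rho> = (\<Sum>j\<in>N - J. e j)"
  have sum_e: "(\<Sum>j\<in>N. e j) = card J + \<rho>"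
    using sum.subset_diff[OF J(1) \<open>finite N\<close>, of e] e_on by (simp add: \<rho>_def)
  have "0 \<le> \<rho>" unfolding \<rho>_def by (intro sum_nonneg) (simp add: e_pos less_imp_le)
  have "\<rho> \<le> (\<Sum>j\<in>N - J. exp (- t))" unfolding \<rho>_def by (intro sum_mono e_off)
  also have "\<dots> \<le> card N * exp (- t)"
    using \<open>finite N\<close> by (simp add: card_mono)
  finally have \<rho>: "\<rho> \<le> card N * exp (- t)" .
  have split: "exp (t * q j) = exp (t * m) * e j" for j
    by (simp add: e_def exp_add[symmetric] algebra_simps)
  have ratio: "exp (t * q j) / (\<Sum>j'\<in>N. exp (t * q j')) = e j / (card J + \<rho>)"
    unfolding split sum_distrib_left[symmetric] sum_e by simp
  show ?thesis
  proof (cases "j \<in> J")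
    case True
    have "\<bar>1 / (card J + \<rho>) - 1 / card J\<bar> = \<rho> / ((card J + \<rho>) * card J)"
    proof -
      have "1 / (card J + \<rho>) - 1 / card J = - (\<rho> / ((card J + \<rho>) * card J))"
        using cJ \<open>0 \<le> \<rho>\<close> by (simp add: divide_simps)
      moreover have "0 \<le> \<rho> / ((card J + \<rho>) * card J)" using \<open>0 \<le> \<rho>\<close> by simp
      ultimately show ?thesis by linarith
    qed
    also have "\<dots> \<le> \<rho> / 1"
      using cJ \<open>0 \<le> \<rho>\<close> mult_mono[of 1 "card J + \<rho>" 1 "card J"] by (intro divide_left_mono) auto
    finally show ?thesis using True \<rho> by (simp add: ratio e_on)
  next
    case False
    have "1 \<le> real (card N)" using cJ card_mono[OF \<open>finite N\<close> J(1)] by linarith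
    have "e j / (card J + \<rho>) \<le> e j / 1"
      using cJ \<open>0 \<le> \<rho>\<close> e_pos[of j] by (intro divide_left_mono) auto
    also have "\<dots> \<le> 1 * exp (- t)" using e_off[of j] False \<open>j \<in> N\<close> by simp
    also have "\<dots> \<le> card N * exp (- t)" using \<open>1 \<le> real (card N)\<close> by (intro mult_right_mono) auto
    finally show ?thesis using False e_pos[of j] cJ \<open>0 \<le> \<rho>\<close> by (simp add: ratio abs_of_nonneg)
  qed
qed

text \<open>The scores are arbitrary, so this also controls the rows on which a head computes
  nothing meaningful.\<close>

lemma softmax_average_bound:
  fixes s y :: "'a \<Rightarrow> real"
  assumes "finite N" "N \<noteq> {}" "\<And>j. j \<in> N \<Longrightarrow> \<bar>y j\<bar> \<le> C"
  shows "\<bar>\<Sum>j\<in>N. exp (s j) / (\<Sum>j'\<in>N. exp (s j')) * y j\<bar> \<le> C"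
proof -
  let ?a = "\<lambda>j. exp (s j) / (\<Sum>j'\<in>N. exp (s j'))"
  have pos: "0 < (\<Sum>j'\<in>N. exp (s j'))" using assms(1,2) by (intro sum_pos) auto
  have "\<bar>\<Sum>j\<in>N. ?a j * y j\<bar> \<le> (\<Sum>j\<in>N. ?a j * C)"
    using assms(3) pos by (intro order_trans[OF sum_abs] sum_mono) (simp add: abs_mult mult_left_mono divide_right_mono)
  also have "\<dots> = C" using pos by (simp add: sum_divide_distrib[symmetric] sum_distrib_right[symmetric])
  finally show ?thesis .
qed

text \<open>The factor \<open>card J\<close> in the values turns the average over \<open>J\<close>
  into a sum. The cube collects the number of summands, the error of each weight and the bound
  \<open>card J \<le> card N\<close>.\<close>

lemma softmax_sum_error:
  fixes q x :: "'a \<Rightarrow> real"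
  assumes "finite N" and J: "J \<subseteq> N" "J \<noteq> {}"
    and on: "\<And>j. j \<in> J \<Longrightarrow> q j = m" and off: "\<And>j. j \<in> N - J \<Longrightarrow> q j \<le> m - 1"
    and "0 \<le> t" and x: "\<And>j. j \<in> N \<Longrightarrow> \<bar>x j\<bar> \<le> B"
  shows "\<bar>(\<Sum>j\<in>N. exp (t * q j) / (\<Sum>j'\<in>N. exp (t * q j')) * (card J * x j)) - (\<Sum>j\<in>J. x j)\<bar>
    \<le> real (card N) ^ 3 * B * exp (- t)"
proof -
  let ?a = "\<lambda>j. exp (t * q j) / (\<Sum>j'\<in>N. exp (t * q j'))"
  let ?u = "\<lambda>j. if j \<in> J then 1 / real (card J) else 0"
  have "finite J" using J \<open>finite N\<close> finite_subset by blast
  then have cJ: "0 < card J" "card J \<le> card N" using J \<open>finite N\<close> by (auto simp: card_gt_0_iff card_mono)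
  have "(\<Sum>j\<in>J. x j) = (\<Sum>j\<in>N. ?u j * (card J * x j))"
    using J \<open>finite N\<close> cJ by (intro sum.mono_neutral_cong_left) auto
  then have "\<bar>(\<Sum>j\<in>N. ?a j * (card J * x j)) - (\<Sum>j\<in>J. x j)\<bar> = \<bar>\<Sum>j\<in>N. (?a j - ?u j) * (card J * x j)\<bar>"
    by (simp only: sum_subtractf[symmetric] left_diff_distrib)
  also have "\<dots> \<le> (\<Sum>j\<in>N. (card N * exp (- t)) * (card N * B))"
  proof (intro order_trans[OF sum_abs] sum_mono)
    fix j assume j: "j \<in> N"
    have "0 \<le> B" using x[OF j] by linarith
    have "\<bar>?a j - ?u j\<bar> \<le> card N * exp (- t)"
      using assms j by (intro softmax_concentrates) auto
    moreover have "\<bar>card J * x j\<bar> \<le> card N * B"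
      unfolding abs_mult using x[OF j] cJ \<open>0 \<le> B\<close> by (intro mult_mono) auto
    ultimately show "\<bar>(?a j - ?u j) * (card J * x j)\<bar> \<le> (card N * exp (- t)) * (card N * B)"
      unfolding abs_mult[of "?a j - ?u j"] by (intro mult_mono) auto
  qed
  also have "\<dots> = real (card N) ^ 3 * B * exp (- t)" by (simp add: power3_eq_cube)
  finally show ?thesis .
qed

text \<open>Every disagreement of \<open>(i, j)\<close> with the pattern of \<open>(r1, r2)\<close> costs exactly 1, so the maximal score
  is attained exactly on the class and exceeds all other scores by at least 1.\<close>

definition pattern_score :: "nat \<Rightarrow> nat \<Rightarrow> nat list \<Rightarrow> nat list \<Rightarrow> nat list \<Rightarrow> nat list \<Rightarrow> real" where
  "pattern_score n k r1 r2 i j =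
     (\<Sum>p<k. \<Sum>q<k. (if r1 ! p = r2 ! q then 1 else - 1) * (if i ! p = j ! q then 1 else 0))
     + (if class_of n k j = class_of n k r2 then 1 else 0)"

text \<open>The scaling factor counts completions of \<open>r1\<close>, not of \<open>i\<close>,
  because the weights of a head cannot depend on the row. Both counts agree when \<open>i\<close>
  has the type of \<open>r1\<close>.\<close>

lemma head_error:
  fixes x :: "nat list \<Rightarrow> real"
  assumes \<mu>: "\<mu> \<in> eq_classes n (2 * k)" and pat: "class_pattern n k \<mu> r1 r2"
    and i: "i \<in> idx n k" "class_of n k i = class_of n k r1"
    and "0 \<le> t" and x: "\<And>j. j \<in> idx n k \<Longrightarrow> \<bar>x j\<bar> \<le> B"
  shows "\<bar>(\<Sum>j\<in>idx n k. exp (t * pattern_score n k r1 r2 i j) / (\<Sum>j'\<in>idx n k. exp (t * pattern_score n k r1 r2 i j'))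
      * (card {j \<in> idx n k. r1 @ j \<in> \<mu>} * x j)) - (\<Sum>j\<in>idx n k. basis_tensor \<mu> (i @ j) * x j)\<bar>
    \<le> real (card (idx n k)) ^ 3 * B * exp (- t)"
proof -
  let ?J = "{j \<in> idx n k. i @ j \<in> \<mu>}"
  have r: "r1 \<in> idx n k" "r2 \<in> idx n k" "r1 @ r2 \<in> \<mu>" using pat by (auto simp: class_pattern_def)
  have card: "card {j \<in> idx n k. r1 @ j \<in> \<mu>} = card ?J"
    using card_completions_eq[of \<mu> n k k r1 i] \<mu> i r by (simp add: mult_2)
  have J: "?J \<noteq> {}"
  proof -
    have "r2 \<in> {j \<in> idx n k. r1 @ j \<in> \<mu>}" using r by simp
    then have "card {j \<in> idx n k. r1 @ j \<in> \<mu>} \<noteq> 0" using finite_idx by (auto simp: card_eq_0_iff)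
    then show ?thesis unfolding card by (metis card.empty)
  qed
  have iff: "j \<in> ?J \<longleftrightarrow> class_of n k j = class_of n k r2 \<and> (\<forall>p<k. \<forall>q<k. i ! p = j ! q \<longleftrightarrow> r1 ! p = r2 ! q)"
    if "j \<in> idx n k" for j
    using pat i that unfolding class_pattern_def by blast
  have "(\<Sum>j\<in>idx n k. basis_tensor \<mu> (i @ j) * x j) = (\<Sum>j\<in>?J. x j)"
    by (rule sum.mono_neutral_cong_right) (auto simp: finite_idx basis_tensor_def)
  moreover have "pattern_score n k r1 r2 i j = (\<Sum>p<k. \<Sum>q<k. if r1 ! p = r2 ! q then 1 else 0) + 1"
    if "j \<in> ?J" for j
    unfolding pattern_score_def using that iff[of j] by (intro pattern_score_gap(1)) simp
  moreover have "pattern_score n k r1 r2 i j \<le> (\<Sum>p<k. \<Sum>q<k. if r1 ! p = r2 ! q then 1 else 0) + 1 - 1"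
    if "j \<in> idx n k - ?J" for j
    unfolding pattern_score_def using that iff[of j] by (intro pattern_score_gap(2)) simp
  ultimately show ?thesis
    unfolding card using J x \<open>0 \<le> t\<close> finite_idx[of n k]
    by (simp only:) (intro softmax_sum_error, auto)
qed

section \<open>Coordinates in blocks and weights supported on chosen coordinates\<close>

lemma block_index_eq_iff:
  fixes v v' d :: nat
  assumes "v < d" "v' < d"
  shows "h * d + v = h' * d + v' \<longleftrightarrow> h = h' \<and> v = v'"
proof
  assume *: "h * d + v = h' * d + v'"
  have "(h * d + v) div d = h" "(h * d + v) mod d = v" "(h' * d + v') div d = h'" "(h' * d + v') mod d = v'"
    using assms by auto
  with * show "h = h' \<and> v = v'" by metis
qed simp

lemma block_index_less:
  fixes v d :: nat
  assumes "v < d" "h < H"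
  shows "h * d + v < H * d"
proof -
  have "h * d + v < Suc h * d" using assms by simp
  also have "\<dots> \<le> H * d" using assms by (intro mult_right_mono) auto
  finally show ?thesis .
qed

lemma linear_form_at_positions:
  fixes x :: "nat \<Rightarrow> real" and w :: "'s \<Rightarrow> real"
  assumes "finite T" "\<And>s. s \<in> T \<Longrightarrow> \<alpha> s < D"
  shows "(\<Sum>a<D. x a * (\<Sum>s\<in>T. if a = \<alpha> s then w s else 0)) = (\<Sum>s\<in>T. x (\<alpha> s) * w s)"
proof -
  have "(\<Sum>a<D. x a * (\<Sum>s\<in>T. if a = \<alpha> s then w s else 0)) = (\<Sum>a<D. \<Sum>s\<in>T. if a = \<alpha> s then x a * w s else 0)"
    unfolding sum_distrib_left by (intro sum.cong refl) auto
  also have "\<dots> = (\<Sum>s\<in>T. \<Sum>a<D. if a = \<alpha> s then x a * w s else 0)" by (rule sum.swap)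
  also have "\<dots> = (\<Sum>s\<in>T. x (\<alpha> s) * w s)" using assms(2) by (intro sum.cong refl) simp
  finally show ?thesis .
qed

text \<open>Coefficients are sums over \<open>T\<close>, so neither \<open>\<alpha>\<close> nor
  \<open>\<beta>\<close> has to be injective. In the application the query coordinate for a triple
  \<open>(p, q, c)\<close> does not depend on \<open>q\<close>.\<close>

lemma bilinear_form_at_positions:
  fixes x y :: "nat \<Rightarrow> real" and w :: "'s \<Rightarrow> real"
  assumes "finite T" "\<And>s. s \<in> T \<Longrightarrow> \<alpha> s < D \<and> \<beta> s < D"
  shows "(\<Sum>e<D. (\<Sum>a<D. x a * (\<Sum>s\<in>T. if a = \<alpha> s \<and> e = \<beta> s then w s else 0)) * y e) =
    (\<Sum>s\<in>T. w s * x (\<alpha> s) * y (\<beta> s))"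
proof -
  have "(\<Sum>e<D. (\<Sum>a<D. x a * (\<Sum>s\<in>T. if a = \<alpha> s \<and> e = \<beta> s then w s else 0)) * y e) =
      (\<Sum>e<D. \<Sum>a<D. \<Sum>s\<in>T. if a = \<alpha> s then (if e = \<beta> s then w s * x a * y e else 0) else 0)"
    unfolding sum_distrib_left sum_distrib_right by (intro sum.cong refl) auto
  also have "\<dots> = (\<Sum>s\<in>T. \<Sum>e<D. \<Sum>a<D. if a = \<alpha> s then (if e = \<beta> s then w s * x a * y e else 0) else 0)"
    by (subst (2) sum.swap, subst sum.swap) (rule refl)
  also have "\<dots> = (\<Sum>s\<in>T. w s * x (\<alpha> s) * y (\<beta> s))"
    using assms(2) by (intro sum.cong refl) simp
  finally show ?thesis .
qed

text \<open>With \<open>w\<^sup>K\<close> the identity, the query weights and bias realise an arbitrary bilinear-affine score;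
  head \<open>h\<close> writes its output to a block of its own, starting at coordinate \<open>Y + h * d\<close>.\<close>

lemma msa_separate_blocks:
  fixes N :: "nat list set" and dT H d Y :: nat and t :: real
    and A wV :: "nat \<Rightarrow> nat \<Rightarrow> nat \<Rightarrow> real" and \<beta> :: "nat \<Rightarrow> nat \<Rightarrow> real"
    and Z :: "nat list \<Rightarrow> nat \<Rightarrow> real"
  assumes "0 < dT"
  defines "M \<equiv> msa N dT H dT d (\<lambda>h a e. t * sqrt dT * A h a e) (\<lambda>h e. t * sqrt dT * \<beta> h e)
      (\<lambda>h a e. if a = e then 1 else 0) (\<lambda>h e. 0) wV (\<lambda>h v c. if c = Y + (h * d + v) then 1 else 0) Z"
    and "S \<equiv> \<lambda>h i j. \<Sum>e<dT. ((\<Sum>a<dT. Z i a * A h a e) + \<beta> h e) * Z j e"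
  shows "c < Y \<Longrightarrow> M i c = 0"
    and "h < H \<Longrightarrow> v < d \<Longrightarrow> M i (Y + (h * d + v)) =
      (\<Sum>j\<in>N. exp (t * S h i j) / (\<Sum>j'\<in>N. exp (t * S h i j')) * tok_matmul dT Z (wV h) j v)"
proof -
  have key: "tok_matmul dT Z (\<lambda>a e. if a = e then 1 else 0) j e = Z j e" if "e < dT" for j e
    unfolding tok_matmul_def using that by (simp add: if_distrib cong: if_cong)
  \<comment> \<open>The factor \<open>sqrt dT\<close> in query weights and bias cancels the
    normalisation of the score, which leaves \<open>t\<close> as inverse temperature.\<close>
  have score: "(\<Sum>e<dT. (tok_matmul dT Z (\<lambda>a e. t * sqrt dT * A h a e) i e + t * sqrt dT * \<beta> h e)
      * (tok_matmul dT Z (\<lambda>a e. if a = e then 1 else 0) j e + 0)) / sqrt dT = t * S h i j" for h i j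
  proof -
    have "(\<Sum>e<dT. (tok_matmul dT Z (\<lambda>a e. t * sqrt dT * A h a e) i e + t * sqrt dT * \<beta> h e)
      * (tok_matmul dT Z (\<lambda>a e. if a = e then 1 else 0) j e + 0)) =
      (\<Sum>e<dT. sqrt dT * (t * (((\<Sum>a<dT. Z i a * A h a e) + \<beta> h e) * Z j e)))"
      by (intro sum.cong refl)
         (simp add: key, simp add: tok_matmul_def sum_distrib_left sum_distrib_right algebra_simps)
    also have "\<dots> = sqrt dT * (t * S h i j)" unfolding S_def by (simp add: sum_distrib_left)
    finally show ?thesis using \<open>0 < dT\<close> by simp
  qed
  have M: "M i c = (\<Sum>h<H. \<Sum>j\<in>N. exp (t * S h i j) / (\<Sum>j'\<in>N. exp (t * S h i j')) *
      (\<Sum>v<d. tok_matmul dT Z (wV h) j v * (if c = Y + (h * d + v) then 1 else 0)))" for c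
    unfolding M_def msa_def Let_def score ..
  show "M i c = 0" if "c < Y" unfolding M using that by simp
  show "M i (Y + (h * d + v)) =
      (\<Sum>j\<in>N. exp (t * S h i j) / (\<Sum>j'\<in>N. exp (t * S h i j')) * tok_matmul dT Z (wV h) j v)"
    if "h < H" "v < d"
  proof -
    have "(\<Sum>v'<d. tok_matmul dT Z (wV h') j v' * (if Y + (h * d + v) = Y + (h' * d + v') then 1 else 0)) =
        (if h' = h then tok_matmul dT Z (wV h) j v else 0)" for h' j
    proof -
      have "(\<Sum>v'<d. tok_matmul dT Z (wV h') j v' * (if Y + (h * d + v) = Y + (h' * d + v') then 1 else 0)) =
          (\<Sum>v'<d. if v' = v then (if h' = h then tok_matmul dT Z (wV h) j v else 0) else 0)"
        using block_index_eq_iff[OF \<open>v < d\<close>] by (intro sum.cong refl) auto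
      then show ?thesis using \<open>v < d\<close> by simp
    qed
    then have "M i (Y + (h * d + v)) = (\<Sum>h'<H. if h' = h then (\<Sum>j\<in>N. exp (t * S h i j) /
        (\<Sum>j'\<in>N. exp (t * S h i j')) * tok_matmul dT Z (wV h) j v) else 0)"
      unfolding M by (intro sum.cong refl) auto
    then show ?thesis using \<open>h < H\<close> by simp
  qed
qed

section \<open>Approximation of equivariant layers\<close>

text \<open>The projection shifts the augmented token by \<open>d\<close> coordinates and fills the
  gap with the bias for its type, which the one-hot identifier selects. Coordinates beyond the
  shifted token match no input coordinate and stay 0, free for the heads.\<close>

lemma embedded_tokens:
  fixes X :: "nat list \<Rightarrow> nat \<Rightarrow> real" and b :: "nat list set \<Rightarrow> nat \<Rightarrow> real"
    and cls :: "nat \<Rightarrow> nat list set" and P :: "nat \<Rightarrow> nat \<Rightarrow> real" and d dp :: nat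
  assumes cls: "bij_betw cls {..<de} (eq_classes n k)" and i: "i \<in> idx n k"
  defines "Z \<equiv> tok_matmul (d + k * dp + de)
      (augment n k d dp P (\<lambda>\<gamma> g. if \<gamma> = cls g then 1 else 0) X)
      (\<lambda>a c. if c < d then (if a < d + k * dp then 0 else b (cls (a - (d + k * dp))) c)
             else if a = c - d then 1 else 0)"
  shows "c < d \<Longrightarrow> Z i c = b (class_of n k i) c"
    and "c < d \<Longrightarrow> Z i (d + c) = X i c"
    and "p < k \<Longrightarrow> c < dp \<Longrightarrow> Z i (2 * d + (p * dp + c)) = P (i ! p) c"
    and "g < de \<Longrightarrow> Z i (2 * d + k * dp + g) = (if class_of n k i = cls g then 1 else 0)"
    and "2 * d + k * dp + de \<le> c \<Longrightarrow> Z i c = 0"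
proof -
  let ?E = "\<lambda>\<gamma> g. if \<gamma> = cls g then 1 else (0::real)"
  let ?x = "augment n k d dp P ?E X i"
  have shifted: "Z i (d + c) = (if c < d + k * dp + de then ?x c else 0)" for c
  proof -
    have "Z i (d + c) = (\<Sum>a<d + k * dp + de. if a = c then ?x a else 0)"
      unfolding Z_def tok_matmul_def by (intro sum.cong refl) auto
    then show ?thesis by simp
  qed
  { assume "c < d"
    obtain g where g: "g < de" "cls g = class_of n k i"
      using cls class_of_in_eq_classes[OF i] unfolding bij_betw_def by (metis imageE lessThan_iff)
    have eq: "class_of n k i = cls g' \<longleftrightarrow> g' = g" if "g' < de" for g'
      using g that cls by (auto simp: bij_betw_def inj_on_def)
    have "Z i c = (\<Sum>a<d + k * dp + de. if a < d + k * dp then 0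
        else ?E (class_of n k i) (a - (d + k * dp)) * b (cls (a - (d + k * dp))) c)"
      unfolding Z_def tok_matmul_def using \<open>c < d\<close> by (intro sum.cong refl) (auto simp: augment_def)
    also have "\<dots> = (\<Sum>g'<de. ?E (class_of n k i) g' * b (cls g') c)"
      using sum_lessThan_append[of "d + k * dp" "\<lambda>_. 0" "\<lambda>g'. ?E (class_of n k i) g' * b (cls g') c" de] by simp
    also have "\<dots> = (\<Sum>g'<de. if g' = g then b (class_of n k i) c else 0)"
      using eq g by (intro sum.cong refl) auto
    finally show "Z i c = b (class_of n k i) c" using g by simp }
  { assume "c < d" then show "Z i (d + c) = X i c" unfolding shifted by (simp add: augment_def) }
  { assume "p < k" "c < dp"
    then show "Z i (2 * d + (p * dp + c)) = P (i ! p) c"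
      using shifted[of "d + (p * dp + c)"] block_index_less[of c dp p k] by (simp add: augment_def mult_2 add.assoc) }
  { assume "g < de"
    then show "Z i (2 * d + k * dp + g) = (if class_of n k i = cls g then 1 else 0)"
      using shifted[of "d + k * dp + g"] by (simp add: augment_def mult_2 add.assoc) }
  { assume "2 * d + k * dp + de \<le> c"
    then show "Z i c = 0" using shifted[of "c - d"] by auto }
qed

text \<open>Compactness refers to the product topology on functions, in which evaluation at a
  coordinate is continuous. Finitely many coordinates then share a bound.\<close>

lemma compact_imp_coordinates_bounded:
  fixes K :: "('a \<Rightarrow> 'b \<Rightarrow> real) set"
  assumes "compact K" "finite I" "finite C"
  obtains B where "0 \<le> B" "\<And>X i c. X \<in> K \<Longrightarrow> i \<in> I \<Longrightarrow> c \<in> C \<Longrightarrow> \<bar>X i c\<bar> \<le> B"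
proof -
  have "\<exists>B. \<forall>X\<in>K. \<bar>X i c\<bar> \<le> B" for i c
  proof -
    have "continuous_on UNIV (\<lambda>X::'a \<Rightarrow> 'b \<Rightarrow> real. X i)" "continuous_on UNIV (\<lambda>x::'b \<Rightarrow> real. x c)"
      by (rule continuous_on_product_coordinates)+
    then have "continuous_on K (\<lambda>X. X i c)"
      using continuous_on_compose2[of UNIV "\<lambda>x::'b \<Rightarrow> real. x c" K "\<lambda>X. X i"] continuous_on_subset by blast
    then have "bounded ((\<lambda>X. X i c) ` K)"
      using assms(1) compact_continuous_image compact_imp_bounded by blast
    then show ?thesis unfolding bounded_iff by auto
  qed
  then obtain B where B: "\<And>i c X. X \<in> K \<Longrightarrow> \<bar>X i c\<bar> \<le> B i c" by metis
  let ?B = "\<Sum>i\<in>I. \<Sum>c\<in>C. \<bar>B i c\<bar>"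
  show thesis
  proof
    show "0 \<le> ?B" by (intro sum_nonneg) auto
    fix X i c assume *: "X \<in> K" "i \<in> I" "c \<in> C"
    have "\<bar>X i c\<bar> \<le> \<bar>B i c\<bar>" using B[OF *(1), of i c] by linarith
    also have "\<dots> \<le> (\<Sum>c\<in>C. \<bar>B i c\<bar>)"
      using * assms by (intro member_le_sum[of c C "\<lambda>c. \<bar>B i c\<bar>"]) auto
    also have "\<dots> \<le> ?B"
      using * assms by (intro member_le_sum[of i I "\<lambda>i. \<Sum>c\<in>C. \<bar>B i c\<bar>"] sum_nonneg) auto
    finally show "\<bar>X i c\<bar> \<le> ?B" .
  qed
qed

theorem theorem1:
  fixes n k d dp :: nat
    and P :: "nat \<Rightarrow> nat \<Rightarrow> real"
    and w :: "nat list set \<Rightarrow> nat \<Rightarrow> nat \<Rightarrow> real"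
    and b :: "nat list set \<Rightarrow> nat \<Rightarrow> real"
    and \<sigma> :: "real \<Rightarrow> real"
    and K :: "(nat list \<Rightarrow> nat \<Rightarrow> real) set"
    and \<delta> :: real
  assumes "0 < n" and "0 < k" and "0 < d" and "0 < dp" and "n \<le> dp"
    and orth: "\<forall>a<n. \<forall>a'<n. (\<Sum>c<dp. P a c * P a' c) = (if a = a' then 1 else 0)"
    and act_cont: "continuous_on UNIV \<sigma>"
    and act_nonpoly: "\<not> (\<exists>p :: real poly. \<forall>x. \<sigma> x = poly p x)"
    and K_sub: "K \<subseteq> {X. \<forall>i c. (i \<notin> idx n k \<or> d \<le> c) \<longrightarrow> X i c = 0}"
    and K_compact: "compact K"
    and "0 < \<delta>"
  shows "\<exists>(de :: nat) (E :: nat list set \<Rightarrow> nat \<Rightarrow> real) (dT :: nat)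
            (win :: nat \<Rightarrow> nat \<Rightarrow> real)
            (dH :: nat) (dv :: nat)
            (wQ :: nat \<Rightarrow> nat \<Rightarrow> nat \<Rightarrow> real) (bQ :: nat \<Rightarrow> nat \<Rightarrow> real)
            (wK :: nat \<Rightarrow> nat \<Rightarrow> nat \<Rightarrow> real) (bK :: nat \<Rightarrow> nat \<Rightarrow> real)
            (wV :: nat \<Rightarrow> nat \<Rightarrow> nat \<Rightarrow> real) (wO :: nat \<Rightarrow> nat \<Rightarrow> nat \<Rightarrow> real)
            (m :: nat) (W1 :: nat \<Rightarrow> nat \<Rightarrow> real) (b1 :: nat \<Rightarrow> real)
            (W2 :: nat \<Rightarrow> nat \<Rightarrow> real) (b2 :: nat \<Rightarrow> real).
          d \<le> dT \<and> 0 < dH \<and>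
          (\<forall>X\<in>K. \<forall>i\<in>idx n k.
             sqrt (\<Sum>c<d. (transformer_layer (idx n k) dT (bell (2*k)) dH dv wQ bQ wK bK wV wO
                              \<sigma> m W1 b1 W2 b2
                              (tok_matmul (d + k*dp + de) (augment n k d dp P E X) win) i c
                           - equiv_layer n k d w b X i c)\<^sup>2) < \<delta>)"
proof -
  define N where "N = idx n k"
  define H where "H = bell (2 * k)"
  define de where "de = card (eq_classes n k)"
  define M where "M = card (eq_classes n (2 * k))"
  have "finite N" by (simp add: N_def finite_idx)
  \<comment> \<open>Heads from \<open>M\<close> up to \<open>H\<close> are padding: nothing is known
    about their \<open>\<mu> h\<close> and \<open>r1 h\<close>, and nothing reads their
    blocks.\<close>
  have "M \<le> H" unfolding M_def H_def by (rule card_eq_classes_le_bell)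
  obtain cls where cls: "bij_betw cls {..<de} (eq_classes n k)"
    using ex_bij_betw_nat_finite[OF finite_eq_classes, of n k] by (auto simp: de_def atLeast0LessThan)
  obtain \<mu> where \<mu>: "bij_betw \<mu> {..<M} (eq_classes n (2 * k))"
    using ex_bij_betw_nat_finite[OF finite_eq_classes, of n "2 * k"] by (auto simp: M_def atLeast0LessThan)
  have \<mu>_class: "\<mu> h \<in> eq_classes n (2 * k)" if "h < M" for h using \<mu> that by (auto simp: bij_betw_def)
  then have "\<forall>h. \<exists>r1 r2. h < M \<longrightarrow> class_pattern n k (\<mu> h) r1 r2" using class_pattern_exists by metis
  then obtain r1 r2 where pat: "\<And>h. h < M \<Longrightarrow> class_pattern n k (\<mu> h) (r1 h) (r2 h)" by metis
  then have r: "r1 h \<in> idx n k" "r2 h \<in> idx n k" if "h < M" for h using that by (auto simp: class_pattern_def)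
  have "\<forall>i\<in>idx n k. \<exists>g. g < de \<and> cls g = class_of n k i"
    using cls class_of_in_eq_classes unfolding bij_betw_def by (metis imageE lessThan_iff)
  then obtain num where num: "\<And>i. i \<in> idx n k \<Longrightarrow> num i < de \<and> cls (num i) = class_of n k i" by metis
  define cnt where "cnt h = real (card {j \<in> idx n k. r1 h @ j \<in> \<mu> h})" for h
  have cnt: "0 \<le> cnt h" "cnt h \<le> card N" for h
    using card_mono[OF \<open>finite N\<close>, of "{j \<in> idx n k. r1 h @ j \<in> \<mu> h}"] by (auto simp: cnt_def N_def)

  define val where "val X h v j = (\<Sum>a<d. X j a * w (\<mu> h) a v)" for X :: "nat list \<Rightarrow> nat \<Rightarrow> real" and h v j
  obtain BX where BX: "0 \<le> BX" "\<And>X i c. X \<in> K \<Longrightarrow> i \<in> N \<Longrightarrow> c \<in> {..<d} \<Longrightarrow> \<bar>X i c\<bar> \<le> BX"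
    using compact_imp_coordinates_bounded[OF K_compact \<open>finite N\<close>, of "{..<d}"] by auto
  define B where "B = (\<Sum>h<M. \<Sum>v<d. BX * (\<Sum>a<d. \<bar>w (\<mu> h) a v\<bar>))"
  have B: "\<bar>val X h v j\<bar> \<le> B" if "X \<in> K" "h < M" "v < d" "j \<in> N" for X h v j
  proof -
    have "\<bar>val X h v j\<bar> \<le> (\<Sum>a<d. BX * \<bar>w (\<mu> h) a v\<bar>)"
      unfolding val_def using BX(2)[OF that(1,4)]
      by (intro order_trans[OF sum_abs] sum_mono) (simp add: abs_mult mult_right_mono)
    also have "\<dots> = BX * (\<Sum>a<d. \<bar>w (\<mu> h) a v\<bar>)" by (simp add: sum_distrib_left)
    also have "\<dots> \<le> (\<Sum>v<d. BX * (\<Sum>a<d. \<bar>w (\<mu> h) a v\<bar>))"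
      using that BX(1) by (intro member_le_sum[of v _ "\<lambda>v. BX * (\<Sum>a<d. \<bar>w (\<mu> h) a v\<bar>)"])
        (auto intro!: mult_nonneg_nonneg sum_nonneg)
    also have "\<dots> \<le> B"
      unfolding B_def using that BX(1)
      by (intro member_le_sum[of h _ "\<lambda>h. \<Sum>v<d. BX * (\<Sum>a<d. \<bar>w (\<mu> h) a v\<bar>)"])
        (auto intro!: mult_nonneg_nonneg sum_nonneg)
    finally show ?thesis .
  qed
  have "0 \<le> B" unfolding B_def using BX(1) by (intro sum_nonneg mult_nonneg_nonneg) auto

  \<comment> \<open>Each coordinate may err by \<open>2 * \<eta>\<close>, one share for the softmax
    and one for the network. The Euclidean norm is at most the sum over \<open>d\<close>
    coordinates, hence at most \<open>\<delta> / 2\<close>.\<close>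
  define \<eta> where "\<eta> = \<delta> / (4 * d)"
  have "0 < \<eta>" using \<open>0 < \<delta>\<close> \<open>0 < d\<close> by (simp add: \<eta>_def)
  \<comment> \<open>All \<open>M\<close> heads together err by at most \<open>C * exp (- t)\<close>.
    Since \<open>exp t\<close> exceeds \<open>t\<close>, the choice \<open>t = C / \<eta>\<close>
    brings this below \<open>\<eta>\<close>, even when \<open>C = 0\<close>.\<close>
  define C where "C = M * (real (card N) ^ 3 * B)"
  define t where "t = C / \<eta>"
  have "0 \<le> C" using \<open>0 \<le> B\<close> by (simp add: C_def)
  then have "0 \<le> t" using \<open>0 < \<eta>\<close> by (simp add: t_def)
  have t: "C * exp (- t) \<le> \<eta>"
  proof -
    have "C = \<eta> * t" using \<open>0 < \<eta>\<close> by (simp add: t_def)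
    also have "\<dots> \<le> \<eta> * exp t" using exp_ge_add_one_self[of t] \<open>0 < \<eta>\<close> by (intro mult_left_mono) linarith+
    finally have "C * exp (- t) \<le> \<eta> * exp t * exp (- t)" by (rule mult_right_mono) simp
    also have "\<dots> = \<eta>" by (simp add: mult.assoc exp_add[symmetric])
    finally show ?thesis .
  qed

  txt \<open>Token coordinates: the output, initialised with the bias, in \<open>[0, d)\<close>; the augmented token in
    \<open>[d, Y)\<close>, its type identifier starting at \<open>G\<close>; the output of head \<open>h\<close> in \<open>d\<close> coordinates
    starting at \<open>Y + h d\<close>.\<close>

  define G where "G = 2 * d + k * dp"
  define Y where "Y = G + de"
  define dT where "dT = Y + H * d"
  have dT: "d \<le> dT" "0 < dT" using \<open>0 < d\<close> by (auto simp: dT_def Y_def G_def)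
  \<comment> \<open>One product per head and output column: \<open>p\<close> is where the head
    writes, \<open>q\<close> the identifier coordinate of the row type that \<open>\<mu> h\<close>
    demands, and \<open>snd\<close>, used as \<open>r\<close> below, the output coordinate that
    receives the product.\<close>
  define S where "S = {..<M} \<times> {..<d}"
  define p where "p = (\<lambda>(h, v). Y + (h * d + v))"
  define q where "q = (\<lambda>(h, v::nat). G + num (r1 h))"
  have pq: "\<forall>s\<in>S. p s < dT \<and> q s < dT"
    using \<open>M \<le> H\<close> num[OF r(1)] block_index_less[of _ d _ H]
    by (fastforce simp: S_def p_def q_def dT_def Y_def)
  define \<zeta> where "\<zeta> = \<eta> / (card S + 1)"
  have "0 < \<zeta>" using \<open>0 < \<eta>\<close> by (simp add: \<zeta>_def add_nonneg_pos)
  have "finite S" by (simp add: S_def)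
  have "\<not> (\<exists>a c. \<forall>x. \<sigma> x = a + c * x)"
  proof
    assume "\<exists>a c. \<forall>x. \<sigma> x = a + c * x"
    then obtain a c where "\<forall>x. \<sigma> x = poly [:a, c:] x" by (auto simp: mult.commute)
    then show False using act_nonpoly by blast
  qed
  \<comment> \<open>In the radius, \<open>card N * B\<close> bounds the head outputs and 1 the
    identifier coordinate.\<close>
  from mlp_approximates_products[OF approximable_square[OF act_cont this] \<open>finite S\<close> \<open>0 < \<zeta>\<close> pq,
      where R = "card N * B + 1" and r = snd]
  obtain m W1 b1 W2 b2 where gate: "\<And>x c. \<forall>s\<in>S. \<bar>x (p s)\<bar> + \<bar>x (q s)\<bar> \<le> card N * B + 1 \<Longrightarrow>
      \<bar>mlp \<sigma> dT m W1 b1 W2 b2 x c - (\<Sum>s\<in>S. if snd s = c then x (p s) * x (q s) else 0)\<bar> \<le> card S * \<zeta>"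
    by blast

  define E :: "nat list set \<Rightarrow> nat \<Rightarrow> real" where "E = (\<lambda>\<gamma> g. if \<gamma> = cls g then 1 else 0)"
  define win where "win = (\<lambda>a c. if c < d then (if a < d + k * dp then 0 else b (cls (a - (d + k * dp))) c)
             else if a = c - d then 1 else 0)"
  define T where "T = {..<k} \<times> {..<k} \<times> {..<dp}"
  \<comment> \<open>A triple \<open>(p, q, c)\<close> couples entry \<open>c\<close> of row
    \<open>i ! p\<close> of \<open>P\<close> with entry \<open>c\<close> of row
    \<open>j ! q\<close>. Summing over \<open>c\<close> gives the inner product, which by
    orthonormality is the indicator of \<open>i ! p = j ! q\<close>.\<close>
  define A :: "nat \<Rightarrow> nat \<Rightarrow> nat \<Rightarrow> real" where "A = (\<lambda>h a e. \<Sum>s\<in>T. if a = (case s of (p, q, c) \<Rightarrow> 2 * d + (p * dp + c)) \<and>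
      e = (case s of (p, q, c) \<Rightarrow> 2 * d + (q * dp + c))
      then (case s of (p, q, c) \<Rightarrow> if r1 h ! p = r2 h ! q then 1 else - 1) else 0)"
  \<comment> \<open>The type of \<open>j\<close> is tested by the query bias alone, since this term
    of the score does not involve \<open>i\<close>.\<close>
  define \<beta> :: "nat \<Rightarrow> nat \<Rightarrow> real" where "\<beta> = (\<lambda>h e. if e = G + num (r2 h) then 1 else 0)"
  \<comment> \<open>Reads \<open>X\<close> from its shifted place and applies the weight of the
    class, scaled by \<open>cnt h\<close> to undo the averaging.\<close>
  define wV where "wV = (\<lambda>h a v. \<Sum>a'<d. if a = d + a' then cnt h * w (\<mu> h) a' v else 0)"
  define wQ where "wQ = (\<lambda>h a e. t * sqrt dT * A h a e)"
  define bQ where "bQ = (\<lambda>h e. t * sqrt dT * \<beta> h e)"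
  define wK :: "nat \<Rightarrow> nat \<Rightarrow> nat \<Rightarrow> real" where "wK = (\<lambda>h a e. if a = e then 1 else 0)"
  define bK :: "nat \<Rightarrow> nat \<Rightarrow> real" where "bK = (\<lambda>h e. 0)"
  define wO :: "nat \<Rightarrow> nat \<Rightarrow> nat \<Rightarrow> real" where "wO = (\<lambda>h v c. if c = Y + (h * d + v) then 1 else 0)"

  have main: "\<bar>transformer_layer (idx n k) dT (bell (2*k)) dT d wQ bQ wK bK wV wO \<sigma> m W1 b1 W2 b2
      (tok_matmul (d + k*dp + de) (augment n k d dp P E X) win) i c - equiv_layer n k d w b X i c\<bar> \<le> 2 * \<eta>"
    if X: "X \<in> K" and i: "i \<in> idx n k" and c: "c < d" for X i c
  proof -
    define Z where "Z = tok_matmul (d + k*dp + de) (augment n k d dp P E X) win"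
    note Z = embedded_tokens[OF cls, where X = X and b = b and d = d and dp = dp and P = P,
        folded E_def win_def, folded Z_def G_def, folded Y_def]
    define sc where "sc h j = (\<Sum>e<dT. ((\<Sum>a<dT. Z i a * A h a e) + \<beta> h e) * Z j e)" for h j
    have sc: "sc h j = pattern_score n k (r1 h) (r2 h) i j" if h: "h < M" and j: "j \<in> idx n k" for h j
    proof -
      have pos: "2 * d + (p * dp + c) < dT" if "p < k" "c < dp" for p c
        using block_index_less[of c dp p k] that by (simp add: dT_def Y_def G_def)
      have "(\<Sum>e<dT. (\<Sum>a<dT. Z i a * A h a e) * Z j e) =
          (\<Sum>(p, q, c)\<in>T. (if r1 h ! p = r2 h ! q then 1 else - 1) * Z i (2 * d + (p * dp + c)) * Z j (2 * d + (q * dp + c)))"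
        unfolding A_def by (subst bilinear_form_at_positions) (auto simp: T_def pos intro!: sum.cong)
      also have "\<dots> = (\<Sum>(p, q, c)\<in>T. (if r1 h ! p = r2 h ! q then 1 else - 1) * (P (i ! p) c * P (j ! q) c))"
        by (intro sum.cong refl) (auto simp: T_def Z(3)[OF i] Z(3)[OF j])
      also have "\<dots> = (\<Sum>p<k. \<Sum>q<k. (if r1 h ! p = r2 h ! q then 1 else - 1) * (\<Sum>c<dp. P (i ! p) c * P (j ! q) c))"
        unfolding T_def by (simp add: sum.cartesian_product[symmetric] sum_distrib_left)
      also have "\<dots> = (\<Sum>p<k. \<Sum>q<k. (if r1 h ! p = r2 h ! q then 1 else - 1) * (if i ! p = j ! q then 1 else 0))"
      proof (intro sum.cong refl)
        fix p q assume "p \<in> {..<k}" "q \<in> {..<k}"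
        then have "i ! p < n" "j ! q < n" using nth_idx_less i j by auto
        then show "(if r1 h ! p = r2 h ! q then 1 else - 1) * (\<Sum>c<dp. P (i ! p) c * P (j ! q) c) =
            (if r1 h ! p = r2 h ! q then 1 else - 1) * (if i ! p = j ! q then 1 else 0)"
          using orth by auto
      qed
      finally have 1: "(\<Sum>e<dT. (\<Sum>a<dT. Z i a * A h a e) * Z j e) = \<dots>" .
      have "G + num (r2 h) < dT" using num[OF r(2)[OF h]] by (simp add: dT_def Y_def)
      then have "(\<Sum>e<dT. \<beta> h e * Z j e) = Z j (G + num (r2 h))"
        by (simp add: \<beta>_def if_distrib[of "\<lambda>x. x * _"] cong: if_cong)
      then have 2: "(\<Sum>e<dT. \<beta> h e * Z j e) = (if class_of n k j = class_of n k (r2 h) then 1 else 0)"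
        using Z(4)[OF j] num[OF r(2)[OF h]] by simp
      show ?thesis
        unfolding sc_def distrib_right sum.distrib 1 2 pattern_score_def ..
    qed
    have tok: "tok_matmul dT Z (wV h) j v = cnt h * val X h v j" if j: "j \<in> idx n k" for h v j
    proof -
      have "tok_matmul dT Z (wV h) j v = (\<Sum>a'<d. Z j (d + a') * (cnt h * w (\<mu> h) a' v))"
        unfolding tok_matmul_def wV_def
        by (rule linear_form_at_positions) (auto simp: dT_def Y_def G_def)
      then show ?thesis by (simp add: Z(2)[OF j] val_def sum_distrib_left mult_ac)
    qed
    define ms where "ms = msa N dT H dT d wQ bQ wK bK wV wO Z i"
    define y where "y h v = (\<Sum>j\<in>N. exp (t * pattern_score n k (r1 h) (r2 h) i j) /
        (\<Sum>j'\<in>N. exp (t * pattern_score n k (r1 h) (r2 h) i j')) * (cnt h * val X h v j))" for h v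
    have ms_y: "ms (Y + (h * d + v)) = y h v" if "h < M" "v < d" for h v
    proof -
      have "h < H" using that \<open>M \<le> H\<close> by simp
      have "ms (Y + (h * d + v)) =
          (\<Sum>j\<in>N. exp (t * sc h j) / (\<Sum>j'\<in>N. exp (t * sc h j')) * tok_matmul dT Z (wV h) j v)"
        unfolding ms_def wQ_def bQ_def wK_def bK_def wO_def sc_def
        by (rule msa_separate_blocks(2)[OF dT(2) \<open>h < H\<close> \<open>v < d\<close>])
      also have "\<dots> = y h v"
        unfolding y_def N_def using sc[OF \<open>h < M\<close>] tok by simp
      finally show ?thesis .
    qed
    \<comment> \<open>Bias and identifier coordinates pass through attention unchanged, so the gate
      sees an exact 0 or 1.\<close>
    have ms_0: "ms c = 0" if "c < Y" for c
      unfolding ms_def wQ_def bQ_def wK_def bK_def wO_def by (rule msa_separate_blocks(1)[OF dT(2) that])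
    define Hm where "Hm c = Z i c + ms c" for c
    \<comment> \<open>The residual connection contributes nothing here, because the head blocks are
      empty before attention.\<close>
    have Hm_p: "Hm (p s) = y (fst s) (snd s)" if "s \<in> S" for s
      using that Z(5)[OF i] ms_y by (auto simp: Hm_def p_def S_def)
    define e where "e h = (if class_of n k i = class_of n k (r1 h) then 1 else (0::real))" for h
    have Hm_q: "Hm (q s) = e (fst s)" if "s \<in> S" for s
    proof -
      have "fst s < M" using that by (auto simp: S_def)
      note g = num[OF r(1)[OF this]]
      have "q s = G + num (r1 (fst s))" by (simp add: q_def split_def)
      then show ?thesis
        using g Z(4)[OF i conjunct1[OF g]] ms_0[of "q s"] by (simp add: Hm_def e_def Y_def)
    qed
    have y_bound: "\<bar>y h v\<bar> \<le> card N * B" if "h < M" "v < d" for h v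
      unfolding y_def
    proof (rule softmax_average_bound[OF \<open>finite N\<close>])
      show "N \<noteq> {}" using i by (auto simp: N_def)
      fix j assume "j \<in> N"
      then show "\<bar>cnt h * val X h v j\<bar> \<le> card N * B"
        unfolding abs_mult using cnt[of h] B[OF X that] \<open>0 \<le> B\<close> by (intro mult_mono) auto
    qed
    have "\<forall>s\<in>S. \<bar>Hm (p s)\<bar> + \<bar>Hm (q s)\<bar> \<le> card N * B + 1"
      using y_bound Hm_p Hm_q by (fastforce simp: S_def e_def)
    note gate_c = gate[OF this, of c]
    have mlp: "\<bar>mlp \<sigma> dT m W1 b1 W2 b2 Hm c - (\<Sum>h<M. y h c * e h)\<bar> \<le> card S * \<zeta>"
    proof -
      have "(\<Sum>s\<in>S. if snd s = c then Hm (p s) * Hm (q s) else 0) =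
          (\<Sum>s\<in>S. if snd s = c then y (fst s) c * e (fst s) else 0)"
        using Hm_p Hm_q by (intro sum.cong refl) auto
      also have "\<dots> = (\<Sum>h<M. \<Sum>v<d. if v = c then y h c * e h else 0)"
        unfolding S_def sum.cartesian_product split_def ..
      also have "\<dots> = (\<Sum>h<M. y h c * e h)" using c by simp
      finally show ?thesis using gate_c by simp
    qed
    \<comment> \<open>On rows of the required type this is the softmax estimate. On all others the
      gate is 0 and \<open>\<mu> h\<close> contains no \<open>i @ j\<close>, so both terms
      vanish.\<close>
    have head: "\<bar>y h c * e h - (\<Sum>j\<in>N. basis_tensor (\<mu> h) (i @ j) * val X h c j)\<bar> \<le> real (card N) ^ 3 * B * exp (- t)"
      if h: "h < M" for h
    proof (cases "class_of n k i = class_of n k (r1 h)")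
      case True
      then show ?thesis
        unfolding y_def cnt_def N_def e_def
        using head_error[OF \<mu>_class[OF h] pat[OF h] i True \<open>0 \<le> t\<close>, of "val X h c" B] B[OF X h c] by (simp add: N_def)
    next
      case False
      then have "i @ j \<notin> \<mu> h" if "j \<in> N" for j
        using pat[OF h] i that unfolding class_pattern_def N_def by blast
      then show ?thesis using False \<open>0 \<le> B\<close> by (simp add: e_def basis_tensor_def)
    qed
    have layer: "equiv_layer n k d w b X i c =
        (\<Sum>h<M. \<Sum>j\<in>N. basis_tensor (\<mu> h) (i @ j) * val X h c j) + b (class_of n k i) c"
    proof -
      have "i \<in> \<nu> \<longleftrightarrow> \<nu> = class_of n k i" if "\<nu> \<in> eq_classes n k" for \<nu>
        using eq_class_eq_class_of[OF that, of i] self_in_class_of[OF i] by metis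
      then have "(\<Sum>\<nu>\<in>eq_classes n k. basis_tensor \<nu> i * b \<nu> c) =
          (\<Sum>\<nu>\<in>eq_classes n k. if \<nu> = class_of n k i then b \<nu> c else 0)"
        by (intro sum.cong refl) (simp add: basis_tensor_def)
      also have "\<dots> = b (class_of n k i) c"
        using class_of_in_eq_classes[OF i] finite_eq_classes by simp
      finally show ?thesis
        unfolding equiv_layer_def val_def N_def
        using sum.reindex_bij_betw[OF \<mu>, of "\<lambda>\<mu>. \<Sum>j\<in>idx n k. basis_tensor \<mu> (i @ j) * (\<Sum>a<d. X j a * w \<mu> a c)"]
        by simp
    qed
    have "transformer_layer (idx n k) dT (bell (2*k)) dT d wQ bQ wK bK wV wO \<sigma> m W1 b1 W2 b2 Z i c =
        Hm c + mlp \<sigma> dT m W1 b1 W2 b2 Hm c"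
      unfolding transformer_layer_def Let_def Hm_def ms_def N_def H_def ..
    moreover have "Hm c = b (class_of n k i) c"
      using Z(1)[OF i c] ms_0[of c] c by (simp add: Hm_def Y_def G_def)
    moreover have "\<bar>(\<Sum>h<M. y h c * e h) - (\<Sum>h<M. \<Sum>j\<in>N. basis_tensor (\<mu> h) (i @ j) * val X h c j)\<bar> \<le> \<eta>"
    proof -
      have "\<bar>(\<Sum>h<M. y h c * e h) - (\<Sum>h<M. \<Sum>j\<in>N. basis_tensor (\<mu> h) (i @ j) * val X h c j)\<bar>
          \<le> (\<Sum>h<M. real (card N) ^ 3 * B * exp (- t))"
        unfolding sum_subtractf[symmetric] using head by (intro order_trans[OF sum_abs] sum_mono) simp
      also have "\<dots> = C * exp (- t)" by (simp add: C_def)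
      finally show ?thesis using t by linarith
    qed
    moreover have "card S * \<zeta> \<le> \<eta>"
      using \<open>0 < \<eta>\<close> by (simp add: \<zeta>_def field_simps)
    ultimately show ?thesis using mlp unfolding layer Z_def by linarith
  qed
  have "sqrt (\<Sum>c<d. (transformer_layer (idx n k) dT (bell (2*k)) dT d wQ bQ wK bK wV wO \<sigma> m W1 b1 W2 b2
      (tok_matmul (d + k*dp + de) (augment n k d dp P E X) win) i c - equiv_layer n k d w b X i c)\<^sup>2) < \<delta>"
    if "X \<in> K" "i \<in> idx n k" for X i
  proof -
    let ?err = "\<lambda>c. transformer_layer (idx n k) dT (bell (2*k)) dT d wQ bQ wK bK wV wO \<sigma> m W1 b1 W2 b2
      (tok_matmul (d + k*dp + de) (augment n k d dp P E X) win) i c - equiv_layer n k d w b X i c"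
    have "sqrt (\<Sum>c<d. (?err c)\<^sup>2) \<le> (\<Sum>c<d. \<bar>?err c\<bar>)"
      using L2_set_le_sum_abs[of ?err "{..<d}"] by (simp add: L2_set_def)
    also have "\<dots> \<le> (\<Sum>c<d. 2 * \<eta>)" using main[OF that] by (intro sum_mono) simp
    also have "\<dots> = \<delta> / 2" using \<open>0 < d\<close> by (simp add: \<eta>_def)
    also have "\<dots> < \<delta>" using \<open>0 < \<delta>\<close> by simp
    finally show ?thesis .
  qed
  then show ?thesis using dT by blast
qed

end
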